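(* Let $X=\{X(t)\}$ be the Markov chain on $\mathbb{R}^\ell$ defined by $X(t+1)=a(X(t),N(t+1))$, and suppose that assumptions (A1)--(A4) (listed in the context) hold. Let $v=e^V$ with $V$ the Lyapunov function of (A4). Suppose that $c\in L_\infty^{v^\eta}$ with $\eta\in(0,1]$. Then, for each $0<\alpha<1$, the function $$h_\alpha(x)=\sum_{t=0}^\infty\alpha^t\,\mathsf{E}_x[c(X(t))],\qquad x\in\mathbb{R}^\ell,$$ exists as an element of $L_\infty^{v^\eta}$. It is a solution to the fixed point equation $$c+\alpha Ph_\alpha-h_\alpha=0,$$ and it is the unique solution among all functions in $L_\infty^{v^\eta}$. If $\eta<1$, then in addition: (i) If $c\in L_\infty^{v^\eta,0}$ then $h_\alpha\in L_\infty^{v^\eta,0}$. (ii) If $c\in L_\infty^{v^\eta,1}$ then $h_\alpha\in L_\infty^{v^\eta,1}$, with gradient $$\nabla h_\alpha=\sum_{t=0}^\infty\alpha^tQ^t\nabla c .$$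
   Context: **Model.** The state space is $\mathsf{X}=\mathbb{R}^\ell$ with Borel $\sigma$-field $\mathcal{B}$. The chain is $X(t+1)=a(X(t),N(t+1))$, $t\ge 0$, where $\{N(t)\}$ are i.i.d. $\mathbb{R}^m$-valued random variables and $a:\mathbb{R}^\ell\times\mathbb{R}^m\to\mathbb{R}^\ell$ is continuous. $P^t(x,A)=\Pr\{X(t)\in A\mid X(0)=x\}$, $P=P^1$, $P^tf(x)=\int f(y)P^t(x,dy)=\mathsf{E}_x[f(X(t))]$. **Assumptions.** (A1) (i) The process $\{N(t)\}$ does not depend on the initial condition $X(0)$. (ii) $a$ is continuously differentiable in its first variable, with $\sup_{x,n}\|\nabla_x a(x,n)\|<\infty$ (any matrix norm), where $[\nabla_x a(x,n)]_{i,j}=\partial a_j(x,n)/\partial x_i$. (A2) For some $t_0\ge1$ there is a continuously differentiable function $p_{t_0}$ on $\mathsf{X}\times\mathsf{X}$ with $P^{t_0}(x,A)=\int_A p_{t_0}(x,y)\,dy$ for all $x\in\mathsf{X}$, $A\in\mathcal{B}$. (A3) There is a state $x_0\in\mathsf{X}$ such that for any $x\in\mathsf{X}$ and any open set $O$ containing $x_0$, $P^t(x,O)>0$ for all $t\ge0$ sufficiently large. (A4) There are functions $V:\mathsf{X}\to(0,\infty)$ and $W:\mathsf{X}\to[1,\infty)$, both continuously differentiable with compact sublevel sets $\{x: F(x)\le r\}$ ($F=V,W$, $r\ge 0$), a compact set $C\subset\mathsf{X}$ and constants $\delta>0$, $b<\infty$ such that (DV3) holds: $\log(Pe^V)-V\le-\delta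 W+b\,\mathbb{I}_C$ on $\mathsf{X}$. Under (A1)--(A4) the chain is known to have a unique invariant probability measure $\pi$ and to be $v$-uniformly ergodic with $v=e^V$ (i.e. there are $b<\infty$, $\rho<1$ with $|P^tf(x)-\pi(f)|\le b\rho^t\|f\|_v v(x)$ for all $f\in L_\infty^v$, $t\ge0$, $x\in\mathsf X$). **Spaces.** For a continuous $w:\mathsf{X}\to[1,\infty)$ (such as $w=v^\eta=e^{\eta V}$): $\|f\|_w=\sup_x|f(x)|/w(x)$; $L_\infty^w=\{f \text{ measurable}:\|f\|_w<\infty\}$; $L_\infty^{w,0}=\{f\in L_\infty^w: f\text{ continuous}\}$ with norm $\|\cdot\|_w$; $L_\infty^{w,1}$ is the space of $f:\mathsf X\to\mathbb{R}$ such that $f,\partial_1f,\dots,\partial_\ell f$ exist and all belong to $L_\infty^{w,0}$, with norm $\|f\|_{w,1}=\max\{\|f\|_w,\|\partial_1f\|_w,\dots,\|\partial_\ell f\|_w\}$. **Sensitivity process and $Q^t$.** $\mathcal{S}(t)$ is the $\ell\times\ell$ matrix $\mathcal{S}_{i,j}(t)=\partial X_i(t)/\partial X_j(0)$; equivalently $\mathcal{S}(0)=I$, $\mathcal{S}(t+1)=\mathcal{A}(t+1)\mathcal{S}(t)$ with $\mathcal{A}^{T}(t)=\nabla_xa(X(t-1),N(t))$. For $g:\mathsf{X}\to\mathbb{R}^\ell$ measurable, $Q^0g=g$ and $Q^tg(x)=\mathsf{E}_x[\mathcal{S}^{T}(t)g(X(t))]$ for $t\ge1$. *)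

theory Defs
  imports "HOL-Probability.Probability"
begin

section \<open>Weighted function spaces\<close>

definition C1_fun :: "('a::real_normed_vector \<Rightarrow> 'b::real_normed_vector) \<Rightarrow> bool" where
  "C1_fun f \<longleftrightarrow>
     (\<exists>f' :: 'a \<Rightarrow> 'a \<Rightarrow>\<^sub>L 'b.
        (\<forall>x. (f has_derivative blinfun_apply (f' x)) (at x)) \<and> continuous_on UNIV f')"

definition has_partials :: "(real ^ 'l \<Rightarrow> real) \<Rightarrow> bool" where
  "has_partials f \<longleftrightarrow> (\<forall>i x. (\<lambda>s. f (x + s *\<^sub>R axis i 1)) differentiable at (0::real))"

definition partial :: "'l::finite \<Rightarrow> (real ^ 'l \<Rightarrow> real) \<Rightarrow> real ^ 'l \<Rightarrow> real" where
  "partial i f x = deriv (\<lambda>s. f (x + s *\<^sub>R axis i 1)) 0"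

definition gradient :: "(real ^ 'l \<Rightarrow> real) \<Rightarrow> real ^ 'l \<Rightarrow> real ^ 'l" where
  "gradient f x = (\<chi> i. partial i f x)"

text \<open>The bound on the range says that the weighted norm \<open>sup\<^sub>x |f x| / w x\<close> is finite.\<close>

definition Linf :: "(real ^ 'l \<Rightarrow> real) \<Rightarrow> (real ^ 'l \<Rightarrow> real) set" where
  "Linf w = {f \<in> borel_measurable borel. bdd_above (range (\<lambda>x. \<bar>f x\<bar> / w x))}"

definition Linf0 :: "(real ^ 'l \<Rightarrow> real) \<Rightarrow> (real ^ 'l \<Rightarrow> real) set" where
  "Linf0 w = {f \<in> Linf w. continuous_on UNIV f}"

definition Linf1 :: "(real ^ 'l \<Rightarrow> real) \<Rightarrow> (real ^ 'l \<Rightarrow> real) set" where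
  "Linf1 w = {f \<in> Linf0 w. has_partials f \<and> (\<forall>i. partial i f \<in> Linf0 w)}"

section \<open>The Markov chain and its sensitivity process\<close>

definition iid_noise :: "'w measure \<Rightarrow> (nat \<Rightarrow> 'w \<Rightarrow> real ^ 'm) \<Rightarrow> bool" where
  "iid_noise M N \<longleftrightarrow>
     prob_space M \<and>
     prob_space.indep_vars M (\<lambda>_. borel) N {1..} \<and>
     (\<forall>s\<ge>1. \<forall>t\<ge>1. distr M borel (N s) = distr M borel (N t))"

text \<open>\<open>chain a N x t\<close> is \<open>X(t)\<close> for the deterministic initial condition \<open>X(0) = x\<close>. All
  initial conditions are driven by the same noise, so the noise does not depend on \<open>X(0)\<close>, and
  conditioning on \<open>X(0) = x\<close> amounts to evaluating the chain started at \<open>x\<close>.\<close>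

primrec chain ::
  "(real ^ 'l \<Rightarrow> real ^ 'm \<Rightarrow> real ^ 'l) \<Rightarrow> (nat \<Rightarrow> 'w \<Rightarrow> real ^ 'm) \<Rightarrow> real ^ 'l \<Rightarrow> nat \<Rightarrow> 'w \<Rightarrow> real ^ 'l"
where
  "chain a N x 0 \<omega> = x"
| "chain a N x (Suc t) \<omega> = a (chain a N x t \<omega>) (N (Suc t) \<omega>)"

definition trans_kernel ::
  "'w measure \<Rightarrow> (real ^ 'l \<Rightarrow> real ^ 'm \<Rightarrow> real ^ 'l) \<Rightarrow> (nat \<Rightarrow> 'w \<Rightarrow> real ^ 'm)
     \<Rightarrow> nat \<Rightarrow> real ^ 'l \<Rightarrow> (real ^ 'l) measure" where
  "trans_kernel M a N t x = distr M borel (chain a N x t)"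

definition trans_op ::
  "'w measure \<Rightarrow> (real ^ 'l \<Rightarrow> real ^ 'm \<Rightarrow> real ^ 'l) \<Rightarrow> (nat \<Rightarrow> 'w \<Rightarrow> real ^ 'm)
     \<Rightarrow> (real ^ 'l \<Rightarrow> real) \<Rightarrow> real ^ 'l \<Rightarrow> real" where
  "trans_op M a N f x = (\<integral>y. f y \<partial>trans_kernel M a N 1 x)"

text \<open>The \<open>(i, j)\<close> entry of \<open>grad_rec a x n\<close> is \<open>\<partial>a\<^sub>j(x, n) / \<partial>x\<^sub>i\<close>, the transpose of the usual
  Jacobian.\<close>

definition grad_rec ::
  "(real ^ 'l \<Rightarrow> real ^ 'm \<Rightarrow> real ^ 'l) \<Rightarrow> real ^ 'l \<Rightarrow> real ^ 'm \<Rightarrow> real ^ 'l ^ 'l" where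
  "grad_rec a x n = transpose (jacobian (\<lambda>y. a y n) (at x))"

primrec sensitivity ::
  "(real ^ 'l \<Rightarrow> real ^ 'm \<Rightarrow> real ^ 'l) \<Rightarrow> (nat \<Rightarrow> 'w \<Rightarrow> real ^ 'm) \<Rightarrow> real ^ 'l \<Rightarrow> nat
     \<Rightarrow> 'w \<Rightarrow> real ^ 'l ^ 'l"
where
  "sensitivity a N x 0 \<omega> = mat 1"
| "sensitivity a N x (Suc t) \<omega> =
     transpose (grad_rec a (chain a N x t \<omega>) (N (Suc t) \<omega>)) ** sensitivity a N x t \<omega>"

definition Q_op ::
  "'w measure \<Rightarrow> (real ^ 'l \<Rightarrow> real ^ 'm \<Rightarrow> real ^ 'l) \<Rightarrow> (nat \<Rightarrow> 'w \<Rightarrow> real ^ 'm)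
     \<Rightarrow> nat \<Rightarrow> (real ^ 'l \<Rightarrow> real ^ 'l) \<Rightarrow> real ^ 'l \<Rightarrow> real ^ 'l" where
  "Q_op M a N t g x =
     (if t = 0 then g x
      else (\<integral>\<omega>. transpose (sensitivity a N x t \<omega>) *v g (chain a N x t \<omega>) \<partial>M))"

definition discounted_value ::
  "'w measure \<Rightarrow> (real ^ 'l \<Rightarrow> real ^ 'm \<Rightarrow> real ^ 'l) \<Rightarrow> (nat \<Rightarrow> 'w \<Rightarrow> real ^ 'm)
     \<Rightarrow> real \<Rightarrow> (real ^ 'l \<Rightarrow> real) \<Rightarrow> real ^ 'l \<Rightarrow> real" where
  "discounted_value M a N \<alpha> c x = (\<Sum>t. \<alpha> ^ t * (\<integral>\<omega>. c (chain a N x t \<omega>) \<partial>M))"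

section \<open>Standing assumptions\<close>

text \<open>Differentiability is in the first variable only, separately for each value of the noise.\<close>

definition smooth_recursion :: "(real ^ 'l \<Rightarrow> real ^ 'm \<Rightarrow> real ^ 'l) \<Rightarrow> bool" where
  "smooth_recursion a \<longleftrightarrow>
     (\<forall>n. C1_fun (\<lambda>x. a x n)) \<and> bounded (range (\<lambda>(x, n). grad_rec a x n))"

definition smooth_density ::
  "'w measure \<Rightarrow> (real ^ 'l \<Rightarrow> real ^ 'm \<Rightarrow> real ^ 'l) \<Rightarrow> (nat \<Rightarrow> 'w \<Rightarrow> real ^ 'm) \<Rightarrow> bool" where
  "smooth_density M a N \<longleftrightarrow>
     (\<exists>t\<^sub>0\<ge>1. \<exists>p :: (real ^ 'l) \<times> (real ^ 'l) \<Rightarrow> real.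
        C1_fun p \<and>
        (\<forall>x. \<forall>A\<in>sets borel.
           set_integrable lborel A (\<lambda>y. p (x, y)) \<and>
           measure (trans_kernel M a N t\<^sub>0 x) A = (LINT y:A|lborel. p (x, y))))"

definition reachable_state ::
  "'w measure \<Rightarrow> (real ^ 'l \<Rightarrow> real ^ 'm \<Rightarrow> real ^ 'l) \<Rightarrow> (nat \<Rightarrow> 'w \<Rightarrow> real ^ 'm) \<Rightarrow> bool" where
  "reachable_state M a N \<longleftrightarrow>
     (\<exists>x\<^sub>0. \<forall>x U. open U \<and> x\<^sub>0 \<in> U \<longrightarrow>
        (\<forall>\<^sub>F t in sequentially. measure (trans_kernel M a N t x) U > 0))"

definition compact_sublevels :: "(real ^ 'l \<Rightarrow> real) \<Rightarrow> bool" where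
  "compact_sublevels F \<longleftrightarrow> (\<forall>r\<ge>0. compact {x. F x \<le> r})"

text \<open>Integrability of \<open>exp V\<close> is implicit in the drift inequality; it is listed
  because the Bochner integral of a non-integrable function is \<open>0\<close>.\<close>

definition drift_DV3 ::
  "'w measure \<Rightarrow> (real ^ 'l \<Rightarrow> real ^ 'm \<Rightarrow> real ^ 'l) \<Rightarrow> (nat \<Rightarrow> 'w \<Rightarrow> real ^ 'm)
     \<Rightarrow> (real ^ 'l \<Rightarrow> real) \<Rightarrow> bool" where
  "drift_DV3 M a N V \<longleftrightarrow>
     (\<forall>x. V x > 0) \<and> C1_fun V \<and> compact_sublevels V \<and>
     (\<exists>W C \<delta> b.
        (\<forall>x. W x \<ge> 1) \<and> C1_fun W \<and> compact_sublevels W \<and> compact C \<and> \<delta> > 0 \<and>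
        (\<forall>x. integrable (trans_kernel M a N 1 x) (\<lambda>y. exp (V y)) \<and>
             ln (trans_op M a N (\<lambda>y. exp (V y)) x) - V x \<le> - \<delta> * W x + b * indicator C x))"

end

theory Submission
  imports Defs
begin

text \<open>Write \<open>P\<^sup>t\<close> for the semigroup, \<open>u = exp (\<eta> V)\<close> and \<open>v = exp V\<close>. By (DV3), Jensen's inequality
  and the compact sublevel sets of \<open>W\<close>, for every \<open>\<epsilon> > 0\<close> there is \<open>B\<close> with \<open>P u \<le> \<epsilon> u + B\<close>. So \<open>P\<^sup>t u\<close>
  is at most a constant times \<open>u\<close>, uniformly in \<open>t\<close>; this gives existence, the fixed point equation,
  and uniqueness, since a difference \<open>d\<close> of two solutions satisfies \<open>d = \<alpha>\<^sup>t P\<^sup>t d\<close>.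

  If \<open>\<eta> < 1\<close>, then \<open>u\<close> is small relative to \<open>v\<close> off large balls. Functions can therefore be
  truncated with an error that is uniformly small on compact sets, which reduces continuity and
  differentiability of \<open>P\<^sup>t c\<close> to dominated convergence.

  For the gradient of the sum, \<open>Q\<^sup>t \<nabla>c = \<nabla> P\<^sup>t c\<close> must be bounded by a multiple of \<open>u\<close> uniformly in \<open>t\<close>.
  If \<open>D\<^sub>t\<close> is the weighted norm of \<open>\<nabla> P\<^sup>t c\<close> and \<open>t\<^sub>0\<close> is the time with a \<open>C\<^sup>1\<close> density, then
  \<open>D\<^sub>s \<le> D\<^sub>t / 2 + C\<close> with \<open>s = t + t\<^sub>0\<close>, where \<open>C\<close> depends on \<open>c\<close> only through its weighted norm.\<close>

section \<open>Calculus\<close>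

text \<open>Domination by u(X(t)) settles one starting point at a time, but continuity and
  differentiability in x call for one integrable bound over all nearby starting points, which (DV3)
  does not directly supply. A cutoff of radius R makes the integrand bounded, and for \<eta> < 1 the
  discarded part is at most a small multiple of v(X(t)), whose expectation is locally bounded in x.
  The cutoff must be C^1 with gradient of order 1/R, because the product rule adds its derivative to
  the gradient.

  The pathwise bound on the sensitivity is only L^t, and \<alpha> L may exceed 1. The inequality for
  \<open>D\<^sub>t\<close> is therefore iterated over blocks of length \<open>t0\<close>, each time
  for P^s c in place of c; the weighted norm of P^s c is bounded uniformly in s, so one additive
  constant serves all blocks. Blocks can be chained because Q^(t0+s) and Q^t0 Q^s, applied to the
  gradient of c, are gradients of the same function.\<close>

lemma has_derivative_imp_partial:
  assumes f: "(f has_derivative (\<lambda>h. g \<bullet> h)) (at x)"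
  shows "((\<lambda>s. f (x + s *\<^sub>R axis i 1)) has_field_derivative g $ i) (at 0)"
    and "partial i f x = g $ i"
proof -
  have f': "(f has_derivative (\<lambda>h. g \<bullet> h)) (at (x + 0 *\<^sub>R axis i 1))" using f by simp
  have "((\<lambda>s. x + s *\<^sub>R axis i 1) has_derivative (\<lambda>s. s *\<^sub>R axis i 1)) (at (0::real))"
    by (auto intro!: derivative_eq_intros)
  from has_derivative_compose[OF this f']
  show *: "((\<lambda>s. f (x + s *\<^sub>R axis i 1)) has_field_derivative g $ i) (at 0)"
    by (simp add: has_field_derivative_def inner_axis mult.commute[of _ "g $ i"])
  then show "partial i f x = g $ i" unfolding partial_def by (rule DERIV_imp_deriv)
qed

lemma has_partials_derivative:
  assumes "has_partials f"
  shows "((\<lambda>s. f (x + s *\<^sub>R axis i 1)) has_field_derivative partial i f (x + s *\<^sub>R axis i 1)) (at s)"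
proof -
  let ?y = "x + s *\<^sub>R axis i 1"
  have "(\<lambda>u. f (?y + u *\<^sub>R axis i 1)) differentiable at (0::real)"
    using assms by (simp add: has_partials_def)
  then have "((\<lambda>u. f (?y + u *\<^sub>R axis i 1)) has_field_derivative partial i f ?y) (at 0)"
    unfolding partial_def by (simp add: DERIV_deriv_iff_real_differentiable)
  then have "((\<lambda>u. f (x + (s + u) *\<^sub>R axis i 1)) has_field_derivative partial i f ?y) (at 0)"
    by (simp add: scaleR_left_distrib add.assoc)
  then show ?thesis
    using DERIV_shift[of "\<lambda>v. f (x + v *\<^sub>R axis i 1)" "partial i f ?y" 0 s] by (simp add: add.commute)
qed

text \<open>The increment from \<open>x\<close> to \<open>x + h\<close> is made one coordinate at a
  time, with \<open>proj I h\<close> marking the stopping points; each leg is a one-variable mean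
  value estimate.\<close>

lemma continuous_partials_imp_has_derivative:
  fixes f :: "real ^ 'l \<Rightarrow> real"
  assumes f: "has_partials f" and cont: "\<And>i. continuous_on UNIV (partial i f)"
  shows "(f has_derivative (\<lambda>h. gradient f x \<bullet> h)) (at x)"
  unfolding has_derivative_at_alt
proof (intro conjI allI impI)
  show "bounded_linear ((\<bullet>) (gradient f x))" by (rule bounded_linear_inner_right)
  fix e :: real assume e: "e > 0"
  \<comment> \<open>There are \<open>CARD('l)\<close> legs, each allowed an error
    \<open>e' * norm h\<close>.\<close>
  define e' where "e' = e / real CARD('l)"
  have e': "e' > 0" using e by (simp add: e'_def)
  have "\<exists>d>0. \<forall>z. dist z x < d \<longrightarrow> \<bar>partial i f z - partial i f x\<bar> < e'" for i
    using cont[of i] e' unfolding continuous_on_iff by (auto simp: dist_real_def)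
  then obtain D where D: "\<And>i. D i > 0"
    "\<And>i z. dist z x < D i \<Longrightarrow> \<bar>partial i f z - partial i f x\<bar> < e'" by metis
  define d where "d = Min (range D)"
  have d: "d > 0" "\<And>i. d \<le> D i" using D(1) by (auto simp: d_def)
  define proj where "proj I h = (\<chi> k. if k \<in> I then h $ k else 0)" for I and h :: "real ^ 'l"
  have *: "\<bar>f (x + proj I h) - f x - (\<Sum>i\<in>I. h $ i * partial i f x)\<bar> \<le> real (card I) * (e' * norm h)"
    if h: "norm h < d" for h I
  proof (induction I rule: finite_induct[OF finite])
    case 1
    show ?case by (simp add: proj_def flip: zero_vec_def)
  next
    case (2 j I)
    let ?y = "x + proj I h"
    \<comment> \<open>Subtracting the linear term makes the derivative of \<open>?\<phi>\<close> a
      difference of two values of one partial derivative, small near \<open>x\<close>.\<close>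
    let ?\<phi> = "\<lambda>s. f (?y + s *\<^sub>R axis j 1) - s * partial j f x"
    have proj: "proj (insert j I) h = proj I h + h $ j *\<^sub>R axis j 1"
      using 2 by (auto simp: proj_def vec_eq_iff axis_def)
    have "norm (?\<phi> (h $ j) - ?\<phi> 0) \<le> e' * norm (h $ j - 0)"
    proof (rule field_differentiable_bound[where S="{-\<bar>h $ j\<bar>..\<bar>h $ j\<bar>}"])
      fix s assume s: "s \<in> {-\<bar>h $ j\<bar>..\<bar>h $ j\<bar>}"
      show "(?\<phi> has_field_derivative (partial j f (?y + s *\<^sub>R axis j 1) - partial j f x))
          (at s within {-\<bar>h $ j\<bar>..\<bar>h $ j\<bar>})"
        by (intro DERIV_diff has_field_derivative_at_within[OF has_partials_derivative[OF f]])
          (auto intro!: derivative_eq_intros)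
      \<comment> \<open>Dropping or shrinking coordinates of \<open>h\<close> does not increase the
        norm, so every leg stays in the ball of radius \<open>d\<close>.\<close>
      have "norm (proj I h + s *\<^sub>R axis j 1) \<le> norm h"
        by (rule norm_le_componentwise_cart) (use 2 s in \<open>auto simp: proj_def axis_def\<close>)
      then have "dist (?y + s *\<^sub>R axis j 1) x < D j"
        using h d(2)[of j] by (simp add: dist_norm add.assoc)
      from D(2)[OF this] show "norm (partial j f (?y + s *\<^sub>R axis j 1) - partial j f x) \<le> e'"
        by simp
    qed auto
    also have "e' * norm (h $ j - 0) \<le> e' * norm h"
      using e' component_le_norm_cart[of h j] by (intro mult_left_mono) auto
    finally show ?case using 2 by (simp add: proj algebra_simps)
  qed
  have "\<bar>f y - f x - gradient f x \<bullet> (y - x)\<bar> \<le> e * norm (y - x)" if "norm (y - x) < d" for y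
  proof -
    have "proj UNIV (y - x) = y - x" by (simp add: proj_def vec_eq_iff)
    then show ?thesis
      using *[OF that, of UNIV]
      by (simp add: inner_vec_def gradient_def e'_def mult.commute)
  qed
  then show "\<exists>d>0. \<forall>y. norm (y - x) < d \<longrightarrow>
      norm (f y - f x - gradient f x \<bullet> (y - x)) \<le> e * norm (y - x)"
    using d(1) by auto
qed

text \<open>A short move along \<open>w\<close> itself changes \<open>f\<close> to first order by
  \<open>norm w\<close> times the distance moved. This converts the Lipschitz bound coming from the
  density into a gradient bound.\<close>

lemma norm_gradient_le_Lipschitz:
  fixes w :: "'a::real_inner"
  assumes f: "(f has_derivative (\<lambda>h. w \<bullet> h)) (at x)" and r: "r > 0" and C: "C \<ge> 0"
    and le: "\<And>y. dist y x < r \<Longrightarrow> \<bar>f y - f x\<bar> \<le> C * norm (y - x)"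
  shows "norm w \<le> C"
proof (rule field_le_epsilon)
  fix e :: real assume e: "e > 0"
  obtain d where d: "d > 0" "\<And>y. norm (y - x) < d \<Longrightarrow> norm (f y - f x - w \<bullet> (y - x)) \<le> e * norm (y - x)"
    using f e unfolding has_derivative_at_alt by blast
  show "norm w \<le> C + e"
  proof (cases "w = 0")
    case True
    then show ?thesis using C e by simp
  next
    case False
    \<comment> \<open>The move then has length \<open>min d r / 2\<close>, inside both
      neighbourhoods.\<close>
    define s where "s = min d r / (2 * norm w)"
    have s: "s > 0" using d r False by (simp add: s_def)
    let ?y = "x + s *\<^sub>R w"
    have n: "norm (?y - x) = min d r / 2" using s False d r by (simp add: s_def)
    have "\<bar>f ?y - f x - w \<bullet> (?y - x)\<bar> \<le> e * norm (?y - x)" using d(2)[of ?y] n d r by auto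
    moreover have "\<bar>f ?y - f x\<bar> \<le> C * norm (?y - x)" using le[of ?y] n d r by (auto simp: dist_norm)
    ultimately have "\<bar>w \<bullet> (?y - x)\<bar> \<le> (C + e) * norm (?y - x)" by (simp add: distrib_right)
    then have "s * norm w * norm w \<le> (C + e) * (s * norm w)" using s by (simp add: dot_square_norm power2_eq_square)
    then have "(s * norm w) * norm w \<le> (s * norm w) * (C + e)" by (simp add: mult.commute)
    then show ?thesis using s False by (subst (asm) mult_le_cancel_left_pos) auto
  qed
qed

text \<open>A limit along one fixed sequence: this is how the sensitivity inherits measurability in
  the noise from the chain, \<open>a\<close> being differentiable only separately for each noise
  value.\<close>

lemma has_derivative_imp_directional_LIMSEQ:
  fixes f :: "'a::real_normed_vector \<Rightarrow> 'b::real_normed_vector"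
  assumes f: "(f has_derivative D) (at x)"
  shows "(\<lambda>k. real (Suc k) *\<^sub>R (f (x + inverse (real (Suc k)) *\<^sub>R h) - f x)) \<longlonglongrightarrow> D h"
proof -
  have f': "(f has_derivative D) (at (x + 0 *\<^sub>R h))" using f by simp
  interpret D: bounded_linear D using f by (rule has_derivative_bounded_linear)
  have "((\<lambda>s. x + s *\<^sub>R h) has_derivative (\<lambda>s. s *\<^sub>R h)) (at (0::real))"
    by (auto intro!: derivative_eq_intros)
  from has_derivative_compose[OF this f']
  have "(\<lambda>s. norm (f (x + s *\<^sub>R h) - f x - s *\<^sub>R D h) / norm s) \<midarrow>0\<rightarrow> 0"
    by (simp add: has_derivative_at D.scaleR)
  moreover have "filterlim (\<lambda>k. inverse (real (Suc k))) (at 0) sequentially"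
    by (rule filterlim_atI[OF LIMSEQ_inverse_real_of_nat]) auto
  ultimately have "(\<lambda>k. norm (f (x + inverse (real (Suc k)) *\<^sub>R h) - f x - inverse (real (Suc k)) *\<^sub>R D h)
      / norm (inverse (real (Suc k)))) \<longlonglongrightarrow> 0"
    by (rule filterlim_compose)
  moreover have "norm (f (x + inverse (real (Suc k)) *\<^sub>R h) - f x - inverse (real (Suc k)) *\<^sub>R D h)
      / norm (inverse (real (Suc k)))
     = norm (real (Suc k) *\<^sub>R (f (x + inverse (real (Suc k)) *\<^sub>R h) - f x) - D h)" for k
  proof -
    have "norm (real (Suc k) *\<^sub>R (f (x + inverse (real (Suc k)) *\<^sub>R h) - f x) - D h)
      = norm (real (Suc k) *\<^sub>R (f (x + inverse (real (Suc k)) *\<^sub>R h) - f x - inverse (real (Suc k)) *\<^sub>R D h))"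
      by (simp add: scaleR_diff_right del: of_nat_Suc)
    also have "\<dots> = norm (f (x + inverse (real (Suc k)) *\<^sub>R h) - f x - inverse (real (Suc k)) *\<^sub>R D h)
      / norm (inverse (real (Suc k)))"
      by (simp add: divide_inverse del: of_nat_Suc)
    finally show ?thesis ..
  qed
  ultimately have "(\<lambda>k. norm (real (Suc k) *\<^sub>R (f (x + inverse (real (Suc k)) *\<^sub>R h) - f x) - D h)) \<longlonglongrightarrow> 0"
    by (simp del: of_nat_Suc)
  then show ?thesis by (simp add: tendsto_norm_zero_iff LIM_zero_iff del: of_nat_Suc)
qed

lemma has_derivative_imp_continuous_on_UNIV:
  assumes "\<And>y. (f has_derivative f' y) (at y)"
  shows "continuous_on UNIV f"
  using has_derivative_continuous[OF assms] by (simp add: continuous_at_imp_continuous_on)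

lemma gradient_eqI:
  assumes "(f has_derivative (\<lambda>h. g \<bullet> h)) (at x)"
  shows "gradient f x = g"
  by (simp add: gradient_def vec_eq_iff has_derivative_imp_partial(2)[OF assms])

lemma continuous_on_UNIV_if_ball:
  fixes f :: "'a::metric_space \<Rightarrow> 'b::topological_space"
  assumes "\<And>x. continuous_on (ball x 1) f"
  shows "continuous_on UNIV f"
proof (rule continuous_at_imp_continuous_on, rule ballI)
  show "isCont f x" for x
    by (rule continuous_on_interior[OF assms[of x]]) simp
qed

text \<open>The derivative is bounded on the compact product of balls, and that product is convex,
  so the mean value inequality applies.\<close>

lemma C1_fun_Lipschitz_on_balls:
  fixes p :: "'a::euclidean_space \<times> 'a \<Rightarrow> real"
  assumes "C1_fun p"
  shows "\<exists>C\<ge>0. \<forall>x\<in>cball 0 r. \<forall>x'\<in>cball 0 r. \<forall>y\<in>cball 0 R. \<bar>p (x, y) - p (x', y)\<bar> \<le> C * norm (x - x')"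
proof -
  obtain p' where p': "\<And>z. (p has_derivative blinfun_apply (p' z)) (at z)"
    and cont: "continuous_on UNIV p'"
    using assms unfolding C1_fun_def by blast
  let ?S = "cball 0 r \<times> cball 0 R :: ('a \<times> 'a) set"
  have cpt: "compact (p' ` ?S)"
    by (intro compact_continuous_image continuous_on_subset[OF cont] compact_Times compact_cball) simp
  then obtain C where C: "C > 0" "\<And>z. z \<in> ?S \<Longrightarrow> norm (p' z) \<le> C"
    using compact_imp_bounded[OF cpt] unfolding bounded_pos by blast
  have "\<bar>p (x, y) - p (x', y)\<bar> \<le> C * norm (x - x')"
    if "x \<in> cball 0 r" "x' \<in> cball 0 r" "y \<in> cball 0 R" for x x' y
  proof -
    have "norm (p (x, y) - p (x', y)) \<le> C * norm ((x, y) - (x', y))"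
    proof (rule differentiable_bound[where S="?S"])
      show "(p has_derivative blinfun_apply (p' z)) (at z within ?S)" for z
        by (rule has_derivative_at_withinI[OF p'])
      show "onorm (blinfun_apply (p' z)) \<le> C" if "z \<in> ?S" for z
        using C(2)[OF that] by (simp add: norm_blinfun.rep_eq)
    qed (use that in \<open>auto intro: convex_Times\<close>)
    then show ?thesis by simp
  qed
  with C(1) show ?thesis by (intro exI[of _ C]) auto
qed

lemma inner_transpose_mult: "(transpose A *v w) \<bullet> h = w \<bullet> (A *v h)"
  for A :: "real ^ 'n ^ 'm"
  by (simp add: transpose_matrix_vector dot_lmul_matrix)

text \<open>Test the hypothesis at \<open>h = transpose A *v w\<close>, use Cauchy-Schwarz and
  cancel one factor of the norm.\<close>

lemma norm_transpose_mult_le: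
  fixes A :: "real ^ 'n ^ 'm"
  assumes "\<And>h. norm (A *v h) \<le> L * norm h"
  shows "norm (transpose A *v w) \<le> L * norm w"
proof (cases "transpose A *v w = 0")
  case True
  have "0 \<le> L * norm (axis i (1::real))" for i :: 'n
    using norm_ge_zero[of "A *v axis i 1"] assms[of "axis i 1"] by linarith
  then have "0 \<le> L" by (simp add: norm_axis_1)
  then show ?thesis unfolding True by simp
next
  case False
  let ?v = "transpose A *v w"
  have "norm ?v * norm ?v = w \<bullet> (A *v ?v)"
    using inner_transpose_mult[of A w ?v] by (simp add: dot_square_norm power2_eq_square)
  also have "\<dots> \<le> norm w * norm (A *v ?v)" by (rule norm_cauchy_schwarz)
  also have "\<dots> \<le> norm w * (L * norm ?v)" by (intro mult_left_mono assms) auto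
  finally have "norm ?v * norm ?v \<le> (L * norm w) * norm ?v" by (simp add: ac_simps)
  with False show ?thesis by (subst (asm) mult_le_cancel_right_pos) auto
qed

section \<open>A C^1 cutoff with explicit constants\<close>

lemma has_field_derivative_max_0_square:
  "((\<lambda>s::real. (max 0 s)\<^sup>2) has_field_derivative 2 * max 0 s) (at s)"
  unfolding has_field_derivative_def has_derivative_at_alt
proof (intro conjI allI impI)
  fix e :: real assume "e > 0"
  \<comment> \<open>Squaring removes the kink of the positive part: the first-order remainder is
    quadratic for every combination of signs, so the radius \<open>e\<close> itself will do.\<close>
  have *: "\<bar>(max 0 y)\<^sup>2 - (max 0 s)\<^sup>2 - 2 * max 0 s * (y - s)\<bar> \<le> \<bar>y - s\<bar> * \<bar>y - s\<bar>" for y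
  proof -
    consider "y \<ge> 0" "s \<ge> 0" | "y \<ge> 0" "s < 0" | "y < 0" "s \<ge> 0" | "y < 0" "s < 0" by linarith
    then show ?thesis
    proof cases
      case 1
      then have "(max 0 y)\<^sup>2 - (max 0 s)\<^sup>2 - 2 * max 0 s * (y - s) = (y - s) * (y - s)"
        by (simp add: power2_eq_square algebra_simps)
      then show ?thesis by (simp only: abs_mult order_refl)
    next
      case 2
      then have "y * y \<le> (y - s) * (y - s)" by (intro mult_mono) auto
      with 2 show ?thesis by (simp add: power2_eq_square flip: abs_mult)
    next
      case 3
      then have *: "0 \<le> s * s" "s * y \<le> 0" "0 \<le> y * y" by (auto simp: mult_nonneg_nonpos)
      have r: "\<bar>y - s\<bar> * \<bar>y - s\<bar> = s * s - 2 * (s * y) + y * y"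
        by (simp add: algebra_simps flip: abs_mult)
      have l: "(max 0 y)\<^sup>2 - (max 0 s)\<^sup>2 - 2 * max 0 s * (y - s) = s * s - 2 * (s * y)"
        using 3 by (simp add: power2_eq_square algebra_simps)
      show ?thesis unfolding l r using * by linarith
    next
      case 4
      then show ?thesis by simp
    qed
  qed
  show "\<exists>d>0. \<forall>y. norm (y - s) < d \<longrightarrow>
      norm ((max 0 y)\<^sup>2 - (max 0 s)\<^sup>2 - 2 * max 0 s * (y - s)) \<le> e * norm (y - s)"
    using \<open>e > 0\<close> by (auto intro!: exI[of _ e] order_trans[OF *] mult_right_mono)
qed (rule bounded_linear_mult_right)

text \<open>A C^1 bump supported in the ball of radius \<open>R\<close> that tends to 1 pointwise as
  \<open>R\<close> grows. It is below 1 away from the origin even inside the ball, hence the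
  quantitative \<open>one_minus_cutoff_le\<close>.\<close>

definition cutoff :: "real \<Rightarrow> 'a::real_inner \<Rightarrow> real" where
  "cutoff R x = (max 0 (1 - (x \<bullet> x) / R\<^sup>2))\<^sup>2"

definition cutoff_grad :: "real \<Rightarrow> 'a::real_inner \<Rightarrow> 'a" where
  "cutoff_grad R x = (- 4 / R\<^sup>2 * max 0 (1 - (x \<bullet> x) / R\<^sup>2)) *\<^sub>R x"

lemma cutoff_has_derivative:
  "(cutoff R has_derivative (\<lambda>h. cutoff_grad R x \<bullet> h)) (at x)"
proof -
  have "((\<lambda>x. 1 - (x \<bullet> x) / R\<^sup>2) has_derivative (\<lambda>h. - (2 * (x \<bullet> h)) / R\<^sup>2)) (at x)"
    by (auto intro!: derivative_eq_intros simp: inner_commute divide_inverse)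
  from has_derivative_compose[OF this has_field_derivative_max_0_square[unfolded has_field_derivative_def]]
  show ?thesis
    unfolding cutoff_def[abs_def] cutoff_grad_def by (simp add: mult.commute mult.left_commute)
qed

lemma cutoff_continuous: "continuous_on S (cutoff R)"
  unfolding cutoff_def divide_inverse by (intro continuous_intros)

lemma cutoff_grad_continuous: "continuous_on S (cutoff_grad R)"
  unfolding cutoff_grad_def divide_inverse by (intro continuous_intros)

lemma cutoff_nonneg: "0 \<le> cutoff R x"
  by (simp add: cutoff_def)

lemma cutoff_le_1: "cutoff R x \<le> 1"
  by (auto simp: cutoff_def intro!: power_le_one)

lemma abs_cutoff_le_1: "\<bar>cutoff R x\<bar> \<le> 1"
  using cutoff_nonneg[of R x] cutoff_le_1[of R x] by simp

lemma cutoff_outside: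
  assumes "R > 0" "norm x > R"
  shows "cutoff R x = 0" "cutoff_grad R x = 0"
proof -
  have "R\<^sup>2 \<le> x \<bullet> x" using assms power_mono[of R "norm x" 2] by (simp add: dot_square_norm)
  then have "1 - (x \<bullet> x) / R\<^sup>2 \<le> 0" using assms by (simp add: field_simps)
  then show "cutoff R x = 0" "cutoff_grad R x = 0" by (simp_all add: cutoff_def cutoff_grad_def)
qed

text \<open>The decay in \<open>R\<close> makes the product-rule term of a truncated gradient vanish
  in the limit.\<close>

lemma norm_cutoff_grad_le:
  assumes R: "R > 0"
  shows "norm (cutoff_grad R x) \<le> 4 / R"
proof (cases "norm x > R")
  case True
  with R show ?thesis by (simp add: cutoff_outside)
next
  case False
  have "norm (cutoff_grad R x) = 4 / R\<^sup>2 * max 0 (1 - (x \<bullet> x) / R\<^sup>2) * norm x"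
    by (simp add: cutoff_grad_def abs_mult)
  also have "\<dots> \<le> 4 / R\<^sup>2 * 1 * R"
    using False R by (intro mult_mono) auto
  also have "\<dots> = 4 / R" using R by (simp add: power2_eq_square)
  finally show ?thesis .
qed

lemma one_minus_cutoff_le: "1 - cutoff R x \<le> 2 * (x \<bullet> x) / R\<^sup>2"
proof -
  define q where "q = (x \<bullet> x) / R\<^sup>2"
  \<comment> \<open>The left side is \<open>2 * q - q * q\<close> for \<open>q \<le> 1\<close>, and
    1 otherwise.\<close>
  have "1 - (max 0 (1 - q))\<^sup>2 \<le> 2 * q"
  proof (cases "q \<le> 1")
    case True
    then show ?thesis by (simp add: power2_eq_square algebra_simps)
  qed simp
  then show ?thesis by (simp add: cutoff_def q_def)
qed

section \<open>The semigroup of the chain\<close>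

locale noise_chain =
  fixes M :: "'w measure"
    and N :: "nat \<Rightarrow> 'w \<Rightarrow> real ^ 'm"
    and a :: "real ^ 'l \<Rightarrow> real ^ 'm \<Rightarrow> real ^ 'l"
  assumes noise: "iid_noise M N"
    and cont: "continuous_on UNIV (\<lambda>(x, n). a x n)"

sublocale noise_chain \<subseteq> prob_space M
  using noise by (simp add: iid_noise_def)

context noise_chain
begin

abbreviation X :: "nat \<Rightarrow> real ^ 'l \<Rightarrow> 'w \<Rightarrow> real ^ 'l" where
  "X t x \<equiv> chain a N x t"

text \<open>An expectation over the noise rather than an integral against the kernel: chains from
  different starting points then share one probability space, and the integrand can be
  differentiated in \<open>x\<close>.\<close>

definition semigroup :: "nat \<Rightarrow> (real ^ 'l \<Rightarrow> real) \<Rightarrow> real ^ 'l \<Rightarrow> real" where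
  "semigroup t f x = (\<integral>\<omega>. f (X t x \<omega>) \<partial>M)"

lemma noise_measurable: "t \<ge> 1 \<Longrightarrow> N t \<in> borel_measurable M"
  using noise by (auto simp: iid_noise_def indep_vars_def)

lemma recursion_measurable [measurable]:
  "(\<lambda>p. a (fst p) (snd p)) \<in> borel_measurable (borel \<Otimes>\<^sub>M borel)"
  using borel_measurable_continuous_onI[OF cont]
  by (simp add: borel_prod split_beta')

lemma chain_measurable_pair:
  "(\<lambda>p. chain a N (fst p) t (snd p)) \<in> borel_measurable (borel \<Otimes>\<^sub>M M)"
proof (induction t)
  case 0
  show ?case by simp
next
  case (Suc t)
  note [measurable] = Suc noise_measurable[of "Suc t", simplified]
  have "(\<lambda>p. a (fst (chain a N (fst p) t (snd p), N (Suc t) (snd p)))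
       (snd (chain a N (fst p) t (snd p), N (Suc t) (snd p)))) \<in> borel_measurable (borel \<Otimes>\<^sub>M M)"
    by (rule measurable_compose[OF _ recursion_measurable]) measurable
  then show ?case by simp
qed

lemma chain_measurable [measurable]: "X t x \<in> borel_measurable M"
proof -
  have "(\<lambda>\<omega>. (\<lambda>p. chain a N (fst p) t (snd p)) (x, \<omega>)) \<in> borel_measurable M"
    by (rule measurable_compose[OF _ chain_measurable_pair]) measurable
  then show ?thesis by simp
qed

lemma chain_continuous: "continuous_on UNIV (\<lambda>x. X t x \<omega>)"
proof (induction t)
  case (Suc t)
  have "continuous_on UNIV (\<lambda>x. (\<lambda>(x, n). a x n) (X t x \<omega>, N (Suc t) \<omega>))"
    by (rule continuous_on_compose2[OF cont]) (auto intro!: continuous_intros Suc)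
  then show ?case by simp
qed simp

lemma semigroup_measurable:
  assumes [measurable]: "f \<in> borel_measurable borel"
  shows "semigroup t f \<in> borel_measurable borel"
proof -
  note [measurable] = chain_measurable_pair
  have "(\<lambda>x. \<integral>\<omega>. f (chain a N (fst (x, \<omega>)) t (snd (x, \<omega>))) \<partial>M) \<in> borel_measurable borel"
    by measurable
  then show ?thesis by (simp add: semigroup_def[abs_def])
qed

section \<open>Independence of the next noise value and the Markov property\<close>

definition noise_law :: "(real ^ 'm) measure" where
  "noise_law = distr M borel (N 1)"

text \<open>\<open>X t x\<close> is a function of the noise at times 1 to \<open>t\<close>, hence
  independent of \<open>N (Suc t)\<close>. The independence of the two restricted noise families is
  pushed forward through the maps that compute the chain and pick the last coordinate.\<close>

lemma distr_chain_noise: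
  "distr M (borel \<Otimes>\<^sub>M borel) (\<lambda>\<omega>. (X t x \<omega>, N (Suc t) \<omega>))
     = distr M borel (X t x) \<Otimes>\<^sub>M noise_law"
proof -
  define I where "I = {1..t}"
  \<comment> \<open>The same recursion, with the coordinates of a point of the product space as
    noise.\<close>
  let ?Y = "\<lambda>z. chain a (\<lambda>i z. z i) x t (z :: nat \<Rightarrow> real ^ 'm)"
  let ?P = "\<lambda>I. Pi\<^sub>M I (\<lambda>_. borel :: (real ^ 'm) measure)"
  let ?R = "\<lambda>I \<omega>. restrict (\<lambda>i. N i \<omega>) I"
  let ?Z = "\<lambda>z :: nat \<Rightarrow> real ^ 'm. z (Suc t)"
  have Y: "(\<lambda>z. chain a (\<lambda>i z. z i) x s z) \<in> borel_measurable (?P I)" if "s \<le> t" for s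
    using that
  proof (induction s)
    case (Suc s)
    then have [measurable]: "(\<lambda>z. chain a (\<lambda>i z. z i) x s z) \<in> borel_measurable (?P I)" by simp
    have [measurable]: "(\<lambda>z. z (Suc s)) \<in> borel_measurable (?P I)"
      by (rule measurable_component_singleton) (use Suc in \<open>auto simp: I_def\<close>)
    have "(\<lambda>z. a (fst (chain a (\<lambda>i z. z i) x s z, z (Suc s)))
       (snd (chain a (\<lambda>i z. z i) x s z, z (Suc s)))) \<in> borel_measurable (?P I)"
      by (rule measurable_compose[OF _ recursion_measurable]) measurable
    then show ?case by simp
  next
    case 0
    show ?case by (subst measurable_cong[where g="\<lambda>_. x"]) simp_all
  qed
  note [measurable] = Y[OF order_refl]
  have Z [measurable]: "?Z \<in> borel_measurable (?P {Suc t})"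
    by (rule measurable_component_singleton) simp
  have eq: "chain a (\<lambda>i z. z i) x s (?R I \<omega>) = X s x \<omega>" if "s \<le> t" for s \<omega>
    using that by (induction s) (auto simp: I_def)
  have ind: "indep_var (?P I) (?R I) (?P {Suc t}) (?R {Suc t})"
    by (rule indep_var_restrict[where I="{1..}"]) (use noise in \<open>auto simp: iid_noise_def I_def\<close>)
  note [measurable] = indep_var_rv1[OF ind] indep_var_rv2[OF ind]
  have dY: "distr M borel (X t x) = distr (distr M (?P I) (?R I)) borel ?Y"
    by (subst distr_distr) (auto simp: comp_def eq)
  have "noise_law = distr M borel (N (Suc t))"
    using noise by (auto simp: noise_law_def iid_noise_def)
  also have dZ: "\<dots> = distr (distr M (?P {Suc t}) (?R {Suc t})) borel ?Z"
    by (subst distr_distr) (auto simp: comp_def)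
  finally have dL: "noise_law = distr (distr M (?P {Suc t}) (?R {Suc t})) borel ?Z" .
  have "distr M borel (X t x) \<Otimes>\<^sub>M noise_law
      = distr (distr M (?P I) (?R I) \<Otimes>\<^sub>M distr M (?P {Suc t}) (?R {Suc t}))
          (borel \<Otimes>\<^sub>M borel) (\<lambda>(y, z). (?Y y, ?Z z))"
    unfolding dY dL
    by (rule pair_measure_distr)
      (auto intro!: prob_space_imp_sigma_finite prob_space.prob_space_distr prob_space_distr)
  also have "\<dots> = distr (distr M (?P I \<Otimes>\<^sub>M ?P {Suc t}) (\<lambda>\<omega>. (?R I \<omega>, ?R {Suc t} \<omega>)))
          (borel \<Otimes>\<^sub>M borel) (\<lambda>(y, z). (?Y y, ?Z z))"
    using ind by (simp add: indep_var_distribution_eq)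
  also have "\<dots> = distr M (borel \<Otimes>\<^sub>M borel) (\<lambda>\<omega>. (X t x \<omega>, N (Suc t) \<omega>))"
    by (subst distr_distr) (auto simp: comp_def eq)
  finally show ?thesis ..
qed

lemma prob_space_noise_law: "prob_space noise_law"
  unfolding noise_law_def by (rule prob_space_distr) (simp add: noise_measurable)

lemma sets_noise_law [simp, measurable_cong]: "sets noise_law = sets borel"
  by (simp add: noise_law_def)

text \<open>Tonelli on the product law; the inner integral is one step driven by an independent copy
  of the noise. The extended version comes first because integrability at later times is derived
  from it.\<close>

lemma nn_integral_chain_Suc:
  assumes f [measurable]: "f \<in> borel_measurable borel"
  shows "(\<integral>\<^sup>+\<omega>. f (X (Suc t) x \<omega>) \<partial>M) = (\<integral>\<^sup>+\<omega>. (\<integral>\<^sup>+\<omega>'. f (X 1 (X t x \<omega>) \<omega>') \<partial>M) \<partial>M)"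
proof -
  interpret L: prob_space noise_law by (rule prob_space_noise_law)
  note [measurable] = noise_measurable[of 1, simplified] noise_measurable[of "Suc t", simplified]
  have m [measurable]: "(\<lambda>p. f (a (fst p) (snd p))) \<in> borel_measurable (borel \<Otimes>\<^sub>M borel)"
    by (rule measurable_compose[OF recursion_measurable f])
  have m': "(\<lambda>n. f (a y n)) \<in> borel_measurable borel" for y
    using measurable_compose[OF measurable_Pair1'[of y borel borel] m] by simp
  have "(\<integral>\<^sup>+\<omega>. f (X (Suc t) x \<omega>) \<partial>M)
      = (\<integral>\<^sup>+p. f (a (fst p) (snd p)) \<partial>distr M (borel \<Otimes>\<^sub>M borel) (\<lambda>\<omega>. (X t x \<omega>, N (Suc t) \<omega>)))"
    by (subst nn_integral_distr) auto
  also have "\<dots> = (\<integral>\<^sup>+y. (\<integral>\<^sup>+n. f (a y n) \<partial>noise_law) \<partial>distr M borel (X t x))"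
    unfolding distr_chain_noise
    by (subst L.nn_integral_fst[symmetric])
       (auto simp: measurable_cong_sets[OF sets_pair_measure_cong[OF sets_distr sets_noise_law] refl])
  also have "\<dots> = (\<integral>\<^sup>+\<omega>. (\<integral>\<^sup>+n. f (a (X t x \<omega>) n) \<partial>noise_law) \<partial>M)"
  proof (rule nn_integral_distr)
    have "(\<lambda>p. f (a (fst p) (snd p))) \<in> borel_measurable (borel \<Otimes>\<^sub>M noise_law)"
      using m by (simp add: measurable_cong_sets[OF sets_pair_measure_cong[OF refl sets_noise_law] refl])
    from L.borel_measurable_nn_integral_fst[OF this]
    show "(\<lambda>y. \<integral>\<^sup>+n. f (a y n) \<partial>noise_law) \<in> borel_measurable (distr M borel (X t x))" by simp
  qed simp
  also have "\<dots> = (\<integral>\<^sup>+\<omega>. (\<integral>\<^sup>+\<omega>'. f (X 1 (X t x \<omega>) \<omega>') \<partial>M) \<partial>M)"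
    unfolding noise_law_def
    by (rule nn_integral_cong, subst nn_integral_distr) (auto intro: m')
  finally show ?thesis .
qed

lemma semigroup_Suc:
  fixes f :: "real ^ 'l \<Rightarrow> real"
  assumes f [measurable]: "f \<in> borel_measurable borel"
    and int: "integrable M (\<lambda>\<omega>. f (X (Suc t) x \<omega>))"
  shows "semigroup (Suc t) f x = semigroup t (semigroup 1 f) x"
proof -
  interpret L: prob_space noise_law by (rule prob_space_noise_law)
  interpret D: prob_space "distr M borel (X t x)" by (rule prob_space_distr) simp
  interpret pair_sigma_finite "distr M borel (X t x)" noise_law ..
  note [measurable] = noise_measurable[of 1, simplified] noise_measurable[of "Suc t", simplified]
  have m [measurable]: "(\<lambda>p. f (a (fst p) (snd p))) \<in> borel_measurable (borel \<Otimes>\<^sub>M borel)"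
    by (rule measurable_compose[OF recursion_measurable f])
  have m': "(\<lambda>n. f (a y n)) \<in> borel_measurable borel" for y
    using measurable_compose[OF measurable_Pair1'[of y borel borel] m] by simp
  let ?g = "\<lambda>p. f (a (fst p) (snd p))"
  have step: "semigroup 1 f y = (\<integral>n. f (a y n) \<partial>noise_law)" for y
    unfolding noise_law_def semigroup_def by (subst integral_distr) (auto intro: m')
  have "integrable (distr M (borel \<Otimes>\<^sub>M borel) (\<lambda>\<omega>. (X t x \<omega>, N (Suc t) \<omega>))) ?g"
    using int by (subst integrable_distr_eq) auto
  then have gi: "integrable (distr M borel (X t x) \<Otimes>\<^sub>M noise_law) ?g"
    by (simp add: distr_chain_noise)
  have "semigroup (Suc t) f x
      = (\<integral>p. ?g p \<partial>distr M (borel \<Otimes>\<^sub>M borel) (\<lambda>\<omega>. (X t x \<omega>, N (Suc t) \<omega>)))"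
    unfolding semigroup_def by (subst integral_distr) auto
  also have "\<dots> = (\<integral>y. semigroup 1 f y \<partial>distr M borel (X t x))"
    using integral_fst'[OF gi] by (simp add: distr_chain_noise step[abs_def] flip: One_nat_def)
  also have "\<dots> = semigroup t (semigroup 1 f) x"
    using semigroup_measurable[OF f, of 1]
    by (subst integral_distr) (auto simp: semigroup_def)
  finally show ?thesis .
qed

lemma trans_op_eq_semigroup:
  "f \<in> borel_measurable borel \<Longrightarrow> trans_op M a N f x = semigroup 1 f x"
  unfolding trans_op_def trans_kernel_def semigroup_def by (subst integral_distr) auto

section \<open>Transition densities and smoothing\<close>

lemma semigroup_density:
  assumes p: "\<forall>A\<in>sets borel. set_integrable lborel A q \<and>
      measure (trans_kernel M a N t x) A = (LINT y:A|lborel. q y)"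
    and f [measurable]: "f \<in> borel_measurable borel"
  shows "integrable lborel q" "semigroup t f x = (\<integral>y. q y * f y \<partial>lborel)"
proof -
  show qi: "integrable lborel q"
    using p[rule_format, of UNIV] by (simp add: set_integrable_def)
  interpret D: prob_space "trans_kernel M a N t x"
    unfolding trans_kernel_def by (rule prob_space_distr) simp
  \<comment> \<open>(A2) does not state a sign for the density; its set integrals are probabilities,
    which makes it nonnegative almost everywhere.\<close>
  have nonneg: "AE y in lborel. 0 \<le> q y"
  proof (rule sigma_finite_measure.density_nonneg[OF sigma_finite_lborel qi])
    fix A :: "(real ^ 'l) set" assume "A \<in> sets lborel"
    then have "(LINT y:A|lborel. q y) = measure (trans_kernel M a N t x) A" using p by simp
    then show "0 \<le> (LINT y:A|lborel. q y)" by simp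
  qed
  have "trans_kernel M a N t x = density lborel (\<lambda>y. ennreal (q y))"
  proof (rule measure_eqI)
    fix A assume "A \<in> sets (trans_kernel M a N t x)"
    then have A: "A \<in> sets borel" by (simp add: trans_kernel_def)
    have "emeasure (trans_kernel M a N t x) A = ennreal (LINT y:A|lborel. q y)"
      using p[rule_format, OF A] by (simp add: D.emeasure_eq_measure)
    also have "\<dots> = (\<integral>\<^sup>+y. ennreal (indicator A y *\<^sub>R q y) \<partial>lborel)"
      unfolding set_lebesgue_integral_def
    proof (rule nn_integral_eq_integral[symmetric])
      show "integrable lborel (\<lambda>y. indicat_real A y *\<^sub>R q y)"
        using p[rule_format, OF A] by (simp add: set_integrable_def)
      show "AE y in lborel. 0 \<le> indicat_real A y *\<^sub>R q y"
        using nonneg by eventually_elim (simp add: indicator_def)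
    qed
    also have "\<dots> = (\<integral>\<^sup>+y. ennreal (q y) * indicator A y \<partial>lborel)"
      by (intro nn_integral_cong) (simp add: indicator_def)
    also have "\<dots> = emeasure (density lborel (\<lambda>y. ennreal (q y))) A"
      using qi A by (subst emeasure_density) auto
    finally show "emeasure (trans_kernel M a N t x) A = emeasure (density lborel (\<lambda>y. ennreal (q y))) A" .
  qed (simp add: trans_kernel_def)
  moreover have "semigroup t f x = (\<integral>y. f y \<partial>trans_kernel M a N t x)"
    unfolding semigroup_def trans_kernel_def by (subst integral_distr) auto
  ultimately show "semigroup t f x = (\<integral>y. q y * f y \<partial>lborel)"
    using qi nonneg by (simp add: integral_density)
qed

text \<open>The difference is the integral of \<open>(p (x, y) - p (x', y)) * f y\<close> over a
  ball, so the regularity in \<open>x\<close> comes from \<open>p\<close> alone and \<open>f\<close>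
  enters only through its sup bound. \<open>C\<close> is fixed before \<open>f\<close> and
  \<open>k\<close>, which later makes it independent of the gradient of \<open>f\<close>.\<close>

lemma semigroup_local_Lipschitz:
  assumes p: "C1_fun p"
    "\<forall>x. \<forall>A\<in>sets borel. set_integrable lborel A (\<lambda>y. p (x, y)) \<and>
      measure (trans_kernel M a N t x) A = (LINT y:A|lborel. p (x, y))"
  shows "\<exists>C\<ge>0. \<forall>f k. f \<in> borel_measurable borel \<longrightarrow> (\<forall>y. \<bar>f y\<bar> \<le> k) \<longrightarrow> (\<forall>y. norm y > R \<longrightarrow> f y = 0) \<longrightarrow>
     (\<forall>x\<in>cball 0 r. \<forall>x'\<in>cball 0 r. \<bar>semigroup t f x - semigroup t f x'\<bar> \<le> C * k * norm (x - x'))"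
proof -
  obtain L where L: "L \<ge> 0" "\<And>x x' y. x \<in> cball 0 r \<Longrightarrow> x' \<in> cball 0 r \<Longrightarrow> y \<in> cball 0 R
      \<Longrightarrow> \<bar>p (x, y) - p (x', y)\<bar> \<le> L * norm (x - x')"
    using C1_fun_Lipschitz_on_balls[OF p(1), of r R] by blast
  let ?B = "cball 0 R :: (real ^ 'l) set"
  have "\<bar>semigroup t f x - semigroup t f x'\<bar> \<le> L * measure lborel ?B * k * norm (x - x')"
    if f [measurable]: "f \<in> borel_measurable borel" and k: "\<And>y. \<bar>f y\<bar> \<le> k" and supp: "\<And>y. norm y > R \<Longrightarrow> f y = 0"
      and x: "x \<in> cball 0 r" "x' \<in> cball 0 r" for f k x x'
  proof -
    have k0: "k \<ge> 0" using k[of 0] by linarith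
    note d = semigroup_density[OF p(2)[THEN spec] f]
    have int: "integrable lborel (\<lambda>y. p (z, y) * f y)" for z
    proof (rule Bochner_Integration.integrable_bound)
      show "integrable lborel (\<lambda>y. k * p (z, y))" using d(1)[of z] by simp
      show "(\<lambda>y. p (z, y) * f y) \<in> borel_measurable lborel"
        using borel_measurable_integrable[OF d(1)[of z]] by simp
      show "AE y in lborel. norm (p (z, y) * f y) \<le> norm (k * p (z, y))"
        using k k0 by (intro always_eventually allI) (simp add: abs_mult mult.commute mult_right_mono)
    qed
    have "semigroup t f x - semigroup t f x' = (\<integral>y. p (x, y) * f y - p (x', y) * f y \<partial>lborel)"
      using int by (simp add: d(2))
    also have "\<bar>\<dots>\<bar> \<le> (\<integral>y. (L * norm (x - x') * k) * indicator ?B y \<partial>lborel)"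
    proof (rule order_trans[OF integral_abs_bound integral_mono])
      show "integrable lborel (\<lambda>y. \<bar>p (x, y) * f y - p (x', y) * f y\<bar>)"
        by (intro integrable_abs Bochner_Integration.integrable_diff int)
      show "integrable lborel (\<lambda>y. (L * norm (x - x') * k) * indicator ?B y)"
        using emeasure_bounded_finite[OF bounded_cball[of "0 :: real ^ 'l" R]]
        by (intro integrable_mult_right) (simp add: integrable_indicator_iff)
      fix y
      show "\<bar>p (x, y) * f y - p (x', y) * f y\<bar> \<le> (L * norm (x - x') * k) * indicator ?B y"
      proof (cases "y \<in> ?B")
        case True
        have "\<bar>p (x, y) * f y - p (x', y) * f y\<bar> = \<bar>p (x, y) - p (x', y)\<bar> * \<bar>f y\<bar>"
          by (simp add: left_diff_distrib flip: abs_mult)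
        also have "\<dots> \<le> (L * norm (x - x')) * k"
          using L k x True by (intro mult_mono) auto
        finally show ?thesis using True by simp
      qed (simp add: supp)
    qed
    also have "\<dots> = L * measure lborel ?B * k * norm (x - x')" by simp
    finally show ?thesis .
  qed
  then show ?thesis using L(1) by (intro exI[of _ "L * measure lborel ?B"]) simp
qed

end

section \<open>The drift condition\<close>

locale drift_chain = noise_chain M N a
  for M :: "'w measure"
    and N :: "nat \<Rightarrow> 'w \<Rightarrow> real ^ 'm"
    and a :: "real ^ 'l \<Rightarrow> real ^ 'm \<Rightarrow> real ^ 'l" +
  fixes V :: "real ^ 'l \<Rightarrow> real"
  assumes drift: "drift_DV3 M a N V"
begin

text \<open>The weight u of the overview; \<open>lyap 1\<close> is v. The exponent is a parameter
  because truncation pays for its error with the larger weight.\<close>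

definition lyap :: "real \<Rightarrow> real ^ 'l \<Rightarrow> real" where
  "lyap \<eta> x = exp (\<eta> * V x)"

lemma V_pos: "0 < V x"
  using drift by (simp add: drift_DV3_def)

lemma V_continuous: "continuous_on UNIV V"
  using drift
  by (auto simp: drift_DV3_def C1_fun_def continuous_on_eq_continuous_at intro: has_derivative_continuous)

lemma compact_V_sublevel: "r \<ge> 0 \<Longrightarrow> compact {x. V x \<le> r}"
  using drift by (simp add: drift_DV3_def compact_sublevels_def)

lemma lyap_continuous: "continuous_on S (lyap \<eta>)"
  unfolding lyap_def using V_continuous by (auto intro!: continuous_intros intro: continuous_on_subset)

lemma lyap_measurable [measurable]: "lyap \<eta> \<in> borel_measurable borel"
  by (intro borel_measurable_continuous_onI lyap_continuous)

lemma lyap_pos [simp]: "0 < lyap \<eta> x"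
  by (simp add: lyap_def)

lemma lyap_nonneg [simp]: "0 \<le> lyap \<eta> x"
  by (simp add: lyap_def)

lemma lyap_ge_1: "0 \<le> \<eta> \<Longrightarrow> 1 \<le> lyap \<eta> x"
  using V_pos[of x] by (simp add: lyap_def)

lemma lyap_mono: "\<eta> \<le> \<theta> \<Longrightarrow> lyap \<eta> x \<le> lyap \<theta> x"
  using V_pos[of x] by (simp add: lyap_def mult_right_mono)

lemma Linf_lyap_iff:
  "f \<in> Linf (\<lambda>x. exp (V x) powr \<eta>) \<longleftrightarrow>
     f \<in> borel_measurable borel \<and> (\<exists>K\<ge>0. \<forall>x. \<bar>f x\<bar> \<le> K * lyap \<eta> x)"
proof -
  have w: "exp (V x) powr \<eta> = lyap \<eta> x" for x
    by (simp add: lyap_def powr_def)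
  have "bdd_above (range (\<lambda>x. \<bar>f x\<bar> / lyap \<eta> x)) \<longleftrightarrow> (\<exists>K. \<forall>x. \<bar>f x\<bar> \<le> K * lyap \<eta> x)"
    by (simp add: bdd_above_def pos_divide_le_eq)
  also have "\<dots> \<longleftrightarrow> (\<exists>K\<ge>0. \<forall>x. \<bar>f x\<bar> \<le> K * lyap \<eta> x)"
  proof safe
    fix K assume K: "\<forall>x. \<bar>f x\<bar> \<le> K * lyap \<eta> x"
    have "0 \<le> K * lyap \<eta> 0" using K[rule_format, of 0] by linarith
    then have "0 \<le> K" using lyap_pos[of \<eta> 0] by (auto simp: zero_le_mult_iff)
    with K show "\<exists>K\<ge>0. \<forall>x. \<bar>f x\<bar> \<le> K * lyap \<eta> x" by blast
  qed blast
  finally show ?thesis by (simp add: Linf_def w)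
qed

text \<open>\<epsilon> is arbitrary because \<open>W\<close> exceeds any given level off a compact
  set, so the drift in the exponent is as strong as desired there. The integral is an extended one
  since integrability at later times comes from iterating this bound.\<close>

lemma lyap_one_step:
  assumes \<eta>: "0 < \<eta>" "\<eta> \<le> 1" and \<epsilon>: "0 < \<epsilon>"
  shows "\<exists>B\<ge>0. \<forall>x. (\<integral>\<^sup>+\<omega>. ennreal (lyap \<eta> (X 1 x \<omega>)) \<partial>M) \<le> ennreal (\<epsilon> * lyap \<eta> x + B)"
proof -
  obtain W C \<delta> b where W: "\<And>x. W x \<ge> 1" "compact_sublevels W" and C: "compact C" and \<delta>: "\<delta> > 0"
    and int: "\<And>x. integrable (trans_kernel M a N 1 x) (\<lambda>y. exp (V y))"
    and dv: "\<And>x. ln (trans_op M a N (\<lambda>y. exp (V y)) x) - V x \<le> - \<delta> * W x + b * indicator C x"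
    using drift unfolding drift_DV3_def by blast
  have [measurable]: "V \<in> borel_measurable borel"
    by (intro borel_measurable_continuous_onI V_continuous)
  have expV [measurable]: "(\<lambda>y. exp (V y)) \<in> borel_measurable borel"
    by measurable
  have int': "integrable M (\<lambda>\<omega>. exp (V (X 1 x \<omega>)))" for x
    using int[of x] unfolding trans_kernel_def by (subst (asm) integrable_distr_eq) auto
  define m where "m x = ln (\<integral>\<omega>. exp (V (X 1 x \<omega>)) \<partial>M)" for x
  \<comment> \<open>\<open>V\<close> is positive, so the expectation is at least 1; positivity lets
    the logarithm in \<open>m\<close> be undone.\<close>
  have E_pos: "0 < (\<integral>\<omega>. exp (V (X 1 x \<omega>)) \<partial>M)" for x
  proof -
    have "(\<integral>\<omega>. 1 \<partial>M) \<le> (\<integral>\<omega>. exp (V (X 1 x \<omega>)) \<partial>M)"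
      by (intro integral_mono int') (auto intro: less_imp_le[OF V_pos])
    then show ?thesis by (simp add: prob_space)
  qed
  have m: "m x \<le> V x - \<delta> * W x + b * indicator C x" for x
    using dv[of x] trans_op_eq_semigroup[OF expV, of x] by (simp add: m_def semigroup_def)
  \<comment> \<open>Jensen's inequality for \<open>y powr \<eta>\<close>, in the form of convexity of \<open>exp\<close>.\<close>
  have jensen: "(\<integral>\<^sup>+\<omega>. ennreal (lyap \<eta> (X 1 x \<omega>)) \<partial>M) \<le> ennreal (exp (\<eta> * m x))" for x
  proof -
    \<comment> \<open>Convexity between 0 and \<open>V - m x\<close>: the bound is affine in
      \<open>exp V\<close>, and centring at \<open>m x\<close> makes its expectation exactly
      \<open>exp (\<eta> * m x)\<close>.\<close>
    let ?g = "\<lambda>\<omega>. exp (\<eta> * m x) * ((1 - \<eta>) + \<eta> * (exp (V (X 1 x \<omega>)) * exp (- m x)))"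
    have le: "lyap \<eta> (X 1 x \<omega>) \<le> ?g \<omega>" for \<omega>
    proof -
      have "exp ((1 - \<eta>) *\<^sub>R 0 + \<eta> *\<^sub>R (V (X 1 x \<omega>) - m x))
          \<le> (1 - \<eta>) * exp 0 + \<eta> * exp (V (X 1 x \<omega>) - m x)"
        using \<eta> convex_onD[OF exp_convex, of \<eta> "0::real" "V (X 1 x \<omega>) - m x"] by simp
      then have "exp (\<eta> * m x) * exp (\<eta> * (V (X 1 x \<omega>) - m x))
          \<le> exp (\<eta> * m x) * ((1 - \<eta>) + \<eta> * exp (V (X 1 x \<omega>) - m x))"
        by (intro mult_left_mono) auto
      then show ?thesis
        by (simp add: lyap_def flip: exp_add) (simp add: algebra_simps)
    qed
    have "(\<integral>\<^sup>+\<omega>. ennreal (lyap \<eta> (X 1 x \<omega>)) \<partial>M) \<le> (\<integral>\<^sup>+\<omega>. ennreal (?g \<omega>) \<partial>M)"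
      by (intro nn_integral_mono ennreal_leI le)
    also have "\<dots> = ennreal (\<integral>\<omega>. ?g \<omega> \<partial>M)"
    proof (intro nn_integral_eq_integral)
      show "integrable M ?g" using int'[of x]
        by (intro integrable_mult_right Bochner_Integration.integrable_add integrable_mult_left) auto
    qed (use \<eta> in auto)
    also have "(\<integral>\<omega>. ?g \<omega> \<partial>M) = exp (\<eta> * m x) * ((1 - \<eta>) + \<eta> * ((\<integral>\<omega>. exp (V (X 1 x \<omega>)) \<partial>M) * exp (- m x)))"
      using int'[of x] by (simp add: prob_space)
    also have "\<dots> = exp (\<eta> * m x)"
      using E_pos[of x] by (simp add: m_def exp_minus)
    finally show ?thesis .
  qed
  \<comment> \<open>With this \<open>r\<close> the drift contributes the factor
    \<open>exp (- \<bar>ln \<epsilon>\<bar>)\<close>, at most \<epsilon>, off the compact set; the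
    absolute value keeps \<open>r\<close> nonnegative when \<epsilon> exceeds 1.\<close>
  define r where "r = \<bar>ln \<epsilon>\<bar> / (\<eta> * \<delta>)"
  have r: "r \<ge> 0" using \<eta> \<delta> by (simp add: r_def)
  have "compact (C \<union> {x. W x \<le> r})"
    using C W(2) r by (intro compact_Un) (auto simp: compact_sublevels_def)
  then have "bounded (V ` (C \<union> {x. W x \<le> r}))"
    using V_continuous by (intro compact_imp_bounded compact_continuous_image) (auto intro: continuous_on_subset)
  then obtain v0 where v0: "\<And>x. x \<in> C \<or> W x \<le> r \<Longrightarrow> \<bar>V x\<bar> \<le> v0"
    unfolding bounded_iff by (metis (mono_tags, lifting) UnCI imageI mem_Collect_eq real_norm_def)
  define B where "B = exp (\<eta> * (v0 + \<bar>b\<bar>))"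
  show ?thesis
  proof (intro exI[of _ B] conjI allI)
    fix x
    note jensen[of x]
    also have "ennreal (exp (\<eta> * m x)) \<le> ennreal (\<epsilon> * lyap \<eta> x + B)"
    proof (rule ennreal_leI, cases "x \<in> C \<or> W x \<le> r")
      case True
      have "m x \<le> v0 + \<bar>b\<bar>"
      proof -
        have "0 \<le> \<delta> * W x" using \<delta> W(1)[of x] by simp
        moreover have "b * indicator C x \<le> \<bar>b\<bar>" by (auto simp: indicator_def)
        ultimately show ?thesis using m[of x] v0[OF True] by linarith
      qed
      then have "exp (\<eta> * m x) \<le> B" using \<eta> by (simp add: B_def)
      then show "exp (\<eta> * m x) \<le> \<epsilon> * lyap \<eta> x + B"
        using \<epsilon> by (simp add: add_increasing)
    next
      case False
      then have "\<delta> * r \<le> \<delta> * W x" using \<delta> by (intro mult_left_mono) auto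
      then have "m x \<le> V x - \<delta> * r" using m[of x] False by (simp add: indicator_def)
      then have "exp (\<eta> * m x) \<le> exp (\<eta> * (V x - \<delta> * r))" using \<eta> by simp
      also have "\<dots> = exp (- \<bar>ln \<epsilon>\<bar>) * lyap \<eta> x"
        using \<eta> \<delta> by (simp add: r_def lyap_def field_simps flip: exp_add)
      also have "\<dots> \<le> \<epsilon> * lyap \<eta> x"
      proof (rule mult_right_mono)
        have "exp (- \<bar>ln \<epsilon>\<bar>) \<le> exp (ln \<epsilon>)" by (subst exp_le_cancel_iff) linarith
        then show "exp (- \<bar>ln \<epsilon>\<bar>) \<le> \<epsilon>" using \<epsilon> by simp
      qed simp
      finally show "exp (\<eta> * m x) \<le> \<epsilon> * lyap \<eta> x + B" by (simp add: B_def add_increasing2)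
    qed
    finally show "(\<integral>\<^sup>+\<omega>. ennreal (lyap \<eta> (X 1 x \<omega>)) \<partial>M) \<le> ennreal (\<epsilon> * lyap \<eta> x + B)" .
  qed (simp add: B_def)
qed

lemma nn_lyap_bound:
  assumes \<eta>: "0 < \<eta>" "\<eta> \<le> 1" and \<epsilon>: "0 < \<epsilon>" "\<epsilon> < 1"
  shows "\<exists>B\<ge>0. \<forall>t x. (\<integral>\<^sup>+\<omega>. ennreal (lyap \<eta> (X t x \<omega>)) \<partial>M) \<le> ennreal (\<epsilon> ^ t * lyap \<eta> x + B)"
proof -
  obtain B where B: "B \<ge> 0"
    and step: "\<And>x. (\<integral>\<^sup>+\<omega>. ennreal (lyap \<eta> (X 1 x \<omega>)) \<partial>M) \<le> ennreal (\<epsilon> * lyap \<eta> x + B)"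
    using lyap_one_step[OF \<eta> \<epsilon>(1)] by blast
  \<comment> \<open>The fixed point of the map sending \<open>s\<close> to
    \<open>\<epsilon> * s + B\<close>, hence an additive constant that survives the
    induction.\<close>
  let ?C = "B / (1 - \<epsilon>)"
  have C: "?C \<ge> 0" using B \<epsilon> by simp
  have "(\<integral>\<^sup>+\<omega>. ennreal (lyap \<eta> (X t x \<omega>)) \<partial>M) \<le> ennreal (\<epsilon> ^ t * lyap \<eta> x + ?C)" for t x
  proof (induction t)
    case 0
    show ?case using C by (simp add: emeasure_space_1 ennreal_leI)
  next
    case (Suc t)
    have "(\<integral>\<^sup>+\<omega>. ennreal (lyap \<eta> (X (Suc t) x \<omega>)) \<partial>M)
        = (\<integral>\<^sup>+\<omega>. (\<integral>\<^sup>+\<omega>'. ennreal (lyap \<eta> (X 1 (X t x \<omega>) \<omega>')) \<partial>M) \<partial>M)"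
      by (rule nn_integral_chain_Suc) measurable
    also have "\<dots> \<le> (\<integral>\<^sup>+\<omega>. ennreal (\<epsilon> * lyap \<eta> (X t x \<omega>) + B) \<partial>M)"
      by (intro nn_integral_mono step)
    also have "\<dots> = (\<integral>\<^sup>+\<omega>. ennreal \<epsilon> * ennreal (lyap \<eta> (X t x \<omega>)) + ennreal B \<partial>M)"
      using \<epsilon> B by (simp add: ennreal_mult)
    also have "\<dots> = ennreal \<epsilon> * (\<integral>\<^sup>+\<omega>. ennreal (lyap \<eta> (X t x \<omega>)) \<partial>M) + ennreal B"
      by (simp add: nn_integral_add nn_integral_cmult emeasure_space_1)
    also have "\<dots> \<le> ennreal \<epsilon> * ennreal (\<epsilon> ^ t * lyap \<eta> x + ?C) + ennreal B"
      by (intro add_right_mono mult_left_mono Suc) auto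
    also have "\<dots> = ennreal (\<epsilon> * (\<epsilon> ^ t * lyap \<eta> x + ?C) + B)"
      using \<epsilon> B C by (simp add: ennreal_mult)
    also have "\<epsilon> * (\<epsilon> ^ t * lyap \<eta> x + ?C) + B = \<epsilon> ^ Suc t * lyap \<eta> x + ?C"
      using \<epsilon> by (simp add: field_simps)
    finally show ?case .
  qed
  with C show ?thesis by blast
qed

lemma lyap_integrable:
  assumes \<eta>: "0 < \<eta>" "\<eta> \<le> 1"
  shows "integrable M (\<lambda>\<omega>. lyap \<eta> (X t x \<omega>))"
proof (rule integrableI_bounded)
  obtain B where "(\<integral>\<^sup>+\<omega>. ennreal (lyap \<eta> (X t x \<omega>)) \<partial>M) \<le> ennreal ((1/2) ^ t * lyap \<eta> x + B)"
    using nn_lyap_bound[OF \<eta>, of "1/2"] by auto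
  then show "(\<integral>\<^sup>+\<omega>. ennreal (norm (lyap \<eta> (X t x \<omega>))) \<partial>M) < \<infinity>"
    by (simp add: le_less_trans)
qed measurable

lemma semigroup_lyap_contraction:
  assumes \<eta>: "0 < \<eta>" "\<eta> \<le> 1" and \<epsilon>: "0 < \<epsilon>" "\<epsilon> < 1"
  shows "\<exists>B\<ge>0. \<forall>t x. semigroup t (lyap \<eta>) x \<le> \<epsilon> ^ t * lyap \<eta> x + B"
proof -
  obtain B where B: "B \<ge> 0"
    "\<And>t x. (\<integral>\<^sup>+\<omega>. ennreal (lyap \<eta> (X t x \<omega>)) \<partial>M) \<le> ennreal (\<epsilon> ^ t * lyap \<eta> x + B)"
    using nn_lyap_bound[OF \<eta> \<epsilon>] by blast
  have "semigroup t (lyap \<eta>) x \<le> \<epsilon> ^ t * lyap \<eta> x + B" for t x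
    using B(2)[of x t] B(1) \<epsilon> nn_integral_eq_integral[OF lyap_integrable[OF \<eta>, of x t]]
    by (simp add: semigroup_def ennreal_le_iff del: ennreal_plus)
  with B(1) show ?thesis by blast
qed

text \<open>The weight is at least 1, so it absorbs the additive constant of the
  contraction.\<close>

lemma semigroup_lyap_bound:
  assumes \<eta>: "0 < \<eta>" "\<eta> \<le> 1"
  shows "\<exists>B\<ge>0. \<forall>t x. semigroup t (lyap \<eta>) x \<le> B * lyap \<eta> x"
proof -
  obtain B where B: "B \<ge> 0" "\<And>t x. semigroup t (lyap \<eta>) x \<le> (1/2) ^ t * lyap \<eta> x + B"
    using semigroup_lyap_contraction[OF \<eta>, of "1/2"] by auto
  have "semigroup t (lyap \<eta>) x \<le> (1 + B) * lyap \<eta> x" for t x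
  proof -
    have "(1/2) ^ t * lyap \<eta> x \<le> 1 * lyap \<eta> x"
      by (intro mult_right_mono power_le_one) auto
    moreover have "B * 1 \<le> B * lyap \<eta> x" using \<eta> by (intro mult_left_mono lyap_ge_1 B) auto
    ultimately show ?thesis using B(2)[of t x] unfolding distrib_right by linarith
  qed
  with B(1) show ?thesis by (intro exI[of _ "1 + B"]) auto
qed

lemma semigroup_lyap_nonneg: "0 \<le> semigroup t (lyap \<eta>) x"
  by (simp add: semigroup_def integral_nonneg_AE)

section \<open>Domination by the weight and discounted series\<close>

lemma dominated_by_lyap:
  fixes F :: "'w \<Rightarrow> 'b::{banach, second_countable_topology}"
  assumes \<eta>: "0 < \<eta>" "\<eta> \<le> 1" and F: "F \<in> borel_measurable M"
    and le: "\<And>\<omega>. norm (F \<omega>) \<le> K * lyap \<eta> (X t x \<omega>)"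
  shows "integrable M F" "norm (\<integral>\<omega>. F \<omega> \<partial>M) \<le> K * semigroup t (lyap \<eta>) x"
proof -
  have i: "integrable M (\<lambda>\<omega>. K * lyap \<eta> (X t x \<omega>))"
    by (intro integrable_mult_right lyap_integrable \<eta>)
  show F': "integrable M F"
    by (rule Bochner_Integration.integrable_bound[OF i F])
       (auto intro!: always_eventually order_trans[OF le] abs_ge_self)
  show "norm (\<integral>\<omega>. F \<omega> \<partial>M) \<le> K * semigroup t (lyap \<eta>) x"
  proof -
    have "norm (\<integral>\<omega>. F \<omega> \<partial>M) \<le> (\<integral>\<omega>. K * lyap \<eta> (X t x \<omega>) \<partial>M)"
      by (rule order_trans[OF integral_norm_bound integral_mono[OF integrable_norm[OF F'] i le]])
    then show ?thesis by (simp add: semigroup_def)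
  qed
qed

lemma lyap_bounded_on_ball: "\<exists>m>0. \<forall>y\<in>cball x r. lyap \<eta> y \<le> m"
proof -
  have "bounded (lyap \<eta> ` cball x r)"
    by (intro compact_imp_bounded compact_continuous_image lyap_continuous compact_cball)
  then obtain m where "m > 0" "\<forall>z\<in>lyap \<eta> ` cball x r. norm z \<le> m"
    unfolding bounded_pos by blast
  then show ?thesis by (intro exI[of _ m]) auto
qed

text \<open>Banach-valued terms cover both P^t c and Q^t of the gradient of c. The hypothesis is
  uniform in \<open>t\<close> and the weight is bounded on unit balls, so the Weierstrass test gives
  uniform convergence there.\<close>

lemma discounted_series:
  fixes u :: "nat \<Rightarrow> real ^ 'l \<Rightarrow> 'b::banach"
  assumes \<alpha>: "0 < \<alpha>" "\<alpha> < 1" and D: "D \<ge> 0" and u: "\<And>t x. norm (u t x) \<le> D * lyap \<eta> x"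
  shows discounted_series_summable: "summable (\<lambda>t. \<alpha> ^ t *\<^sub>R u t x)"
    and discounted_series_bound: "norm (\<Sum>t. \<alpha> ^ t *\<^sub>R u t x) \<le> D / (1 - \<alpha>) * lyap \<eta> x"
    and discounted_series_uniform: "uniform_limit (ball x 1) (\<lambda>n y. \<Sum>t<n. \<alpha> ^ t *\<^sub>R u t y)
          (\<lambda>y. \<Sum>t. \<alpha> ^ t *\<^sub>R u t y) sequentially"
    and discounted_series_continuous:
      "(\<And>t. continuous_on UNIV (u t)) \<Longrightarrow> continuous_on UNIV (\<lambda>y. \<Sum>t. \<alpha> ^ t *\<^sub>R u t y)"
proof -
  have geo: "summable (\<lambda>t. \<alpha> ^ t * k)" for k
    using \<alpha> by (intro summable_mult2 summable_geometric) auto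
  have le: "norm (\<alpha> ^ t *\<^sub>R u t x) \<le> \<alpha> ^ t * (D * lyap \<eta> x)" for t x
    using \<alpha> u[of t x] by (simp add: mult_left_mono)
  have sn: "summable (\<lambda>t. norm (\<alpha> ^ t *\<^sub>R u t x))" for x
    by (rule summable_comparison_test'[OF geo, of 0]) (use le in auto)
  then show "summable (\<lambda>t. \<alpha> ^ t *\<^sub>R u t x)" by (rule summable_norm_cancel)
  have "norm (\<Sum>t. \<alpha> ^ t *\<^sub>R u t x) \<le> (\<Sum>t. norm (\<alpha> ^ t *\<^sub>R u t x))" by (rule summable_norm[OF sn])
  also have "\<dots> \<le> (\<Sum>t. \<alpha> ^ t * (D * lyap \<eta> x))" by (rule suminf_le[OF le sn geo])
  also have "\<dots> = D / (1 - \<alpha>) * lyap \<eta> x"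
    using \<alpha> by (subst suminf_mult2[symmetric]) (auto simp: suminf_geometric summable_geometric)
  finally show "norm (\<Sum>t. \<alpha> ^ t *\<^sub>R u t x) \<le> D / (1 - \<alpha>) * lyap \<eta> x" .
  show unif: "uniform_limit (ball x 1) (\<lambda>n y. \<Sum>t<n. \<alpha> ^ t *\<^sub>R u t y) (\<lambda>y. \<Sum>t. \<alpha> ^ t *\<^sub>R u t y) sequentially" for x
  proof -
    obtain m where m: "\<And>y. y \<in> cball x 1 \<Longrightarrow> lyap \<eta> y \<le> m"
      using lyap_bounded_on_ball by blast
    show ?thesis
    proof (rule Weierstrass_m_test[OF _ geo])
      fix t y assume "y \<in> ball x 1"
      then have "\<alpha> ^ t * (D * lyap \<eta> y) \<le> \<alpha> ^ t * (D * m)"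
        using \<alpha> D m[of y] by (intro mult_left_mono) auto
      with le[of t y] show "norm (\<alpha> ^ t *\<^sub>R u t y) \<le> \<alpha> ^ t * (D * m)" by linarith
    qed
  qed
  show "continuous_on UNIV (\<lambda>y. \<Sum>t. \<alpha> ^ t *\<^sub>R u t y)" if uc: "\<And>t. continuous_on UNIV (u t)"
  proof -
    have "continuous_on (ball x 1) (\<lambda>y. \<Sum>t. \<alpha> ^ t *\<^sub>R u t y)" for x
      by (rule uniform_limit_theorem[OF always_eventually unif])
        (auto intro!: continuous_intros continuous_on_subset[OF uc])
    then show ?thesis by (rule continuous_on_UNIV_if_ball)
  qed
qed

section \<open>The weighted spaces of continuous and C^1 functions\<close>

lemma Linf0_lyap_iff:
  "f \<in> Linf0 (\<lambda>x. exp (V x) powr \<eta>) \<longleftrightarrow>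
     continuous_on UNIV f \<and> (\<exists>K\<ge>0. \<forall>x. \<bar>f x\<bar> \<le> K * lyap \<eta> x)"
  unfolding Linf0_def Linf_lyap_iff mem_Collect_eq using borel_measurable_continuous_onI by blast

text \<open>The space is given by partial derivatives, whereas composition with the chain uses total
  derivatives; continuity of the partials bridges the two.\<close>

lemma Linf1_lyapD:
  assumes "f \<in> Linf1 (\<lambda>x. exp (V x) powr \<eta>)"
  shows "(f has_derivative (\<lambda>h. gradient f x \<bullet> h)) (at x)"
    and "continuous_on UNIV (gradient f)"
    and "\<exists>D\<ge>0. \<forall>x. norm (gradient f x) \<le> D * lyap \<eta> x"
proof -
  have f: "has_partials f" "\<And>i. partial i f \<in> Linf0 (\<lambda>x. exp (V x) powr \<eta>)"
    using assms by (auto simp: Linf1_def)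
  then have cont: "\<And>i. continuous_on UNIV (partial i f)" by (simp add: Linf0_lyap_iff)
  show "(f has_derivative (\<lambda>h. gradient f x \<bullet> h)) (at x)"
    by (rule continuous_partials_imp_has_derivative[OF f(1) cont])
  show "continuous_on UNIV (gradient f)"
    unfolding gradient_def by (intro continuous_on_vec_lambda cont)
  have "\<forall>i. \<exists>D\<ge>0. \<forall>x. \<bar>partial i f x\<bar> \<le> D * lyap \<eta> x"
    using f(2) by (simp add: Linf0_lyap_iff)
  then obtain D where D: "\<And>i. D i \<ge> 0" "\<And>i x. \<bar>partial i f x\<bar> \<le> D i * lyap \<eta> x" by metis
  have "norm (gradient f x) \<le> (\<Sum>i\<in>UNIV. D i) * lyap \<eta> x" for x
  proof -
    have "norm (gradient f x) \<le> (\<Sum>i\<in>UNIV. \<bar>gradient f x $ i\<bar>)" by (rule norm_le_l1_cart)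
    also have "\<dots> \<le> (\<Sum>i\<in>UNIV. D i * lyap \<eta> x)"
      by (intro sum_mono) (simp add: gradient_def D)
    finally show ?thesis by (simp add: sum_distrib_right)
  qed
  then show "\<exists>D\<ge>0. \<forall>x. norm (gradient f x) \<le> D * lyap \<eta> x"
    using D(1) by (intro exI[of _ "\<Sum>i\<in>UNIV. D i"]) (auto intro: sum_nonneg)
qed

lemma Linf1_lyapI:
  assumes f: "f \<in> Linf (\<lambda>x. exp (V x) powr \<eta>)" "\<And>x. (f has_derivative (\<lambda>h. g x \<bullet> h)) (at x)"
    and g: "continuous_on UNIV g" "\<And>x. norm (g x) \<le> D * lyap \<eta> x" "D \<ge> 0"
  shows "f \<in> Linf1 (\<lambda>x. exp (V x) powr \<eta>)"
proof -
  have "partial i f = (\<lambda>x. g x $ i)" for i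
    using has_derivative_imp_partial(2)[OF f(2)] by (simp add: fun_eq_iff)
  moreover have "\<bar>g x $ i\<bar> \<le> D * lyap \<eta> x" for i x
    using component_le_norm_cart[of "g x" i] g(2)[of x] by linarith
  moreover have "has_partials f"
    unfolding has_partials_def real_differentiable_def
    using has_derivative_imp_partial(1)[OF f(2)] by blast
  moreover have "f \<in> Linf0 (\<lambda>x. exp (V x) powr \<eta>)"
    using f(1) has_derivative_imp_continuous_on_UNIV[OF f(2)] by (simp add: Linf0_def)
  ultimately show ?thesis
    using g by (auto simp: Linf1_def Linf0_lyap_iff intro: continuous_on_component)
qed

section \<open>The discounted value function\<close>

lemma semigroup_estimate:
  assumes \<eta>: "0 < \<eta>" "\<eta> \<le> 1" and f [measurable]: "f \<in> borel_measurable borel"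
    and le: "\<And>x. \<bar>f x\<bar> \<le> K * lyap \<eta> x"
  shows "integrable M (\<lambda>\<omega>. f (X t x \<omega>))" "\<bar>semigroup t f x\<bar> \<le> K * semigroup t (lyap \<eta>) x"
proof -
  have "(\<lambda>\<omega>. f (X t x \<omega>)) \<in> borel_measurable M" by measurable
  from dominated_by_lyap[OF \<eta> this, where K=K and t=t and x=x] le
  show "integrable M (\<lambda>\<omega>. f (X t x \<omega>))" "\<bar>semigroup t f x\<bar> \<le> K * semigroup t (lyap \<eta>) x"
    by (simp_all add: semigroup_def)
qed

lemma semigroup_weighted_bound:
  assumes \<eta>: "0 < \<eta>" "\<eta> \<le> 1" and f: "f \<in> borel_measurable borel"
    and K: "K \<ge> 0" and le: "\<And>x. \<bar>f x\<bar> \<le> K * lyap \<eta> x"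
  shows "\<exists>K'\<ge>0. \<forall>t x. \<bar>semigroup t f x\<bar> \<le> K' * lyap \<eta> x"
proof -
  obtain B where B: "B \<ge> 0" "\<And>t x. semigroup t (lyap \<eta>) x \<le> B * lyap \<eta> x"
    using semigroup_lyap_bound[OF \<eta>] by blast
  have "\<bar>semigroup t f x\<bar> \<le> K * B * lyap \<eta> x" for t x
    using semigroup_estimate(2)[OF \<eta> f le, of t x] mult_left_mono[OF B(2)[of t x] K]
    by (simp add: mult.assoc)
  with B K show ?thesis by (intro exI[of _ "K * B"]) auto
qed

text \<open>Induction on \<open>t\<close> with \<open>f\<close> generalised: peeling off a step
  replaces \<open>f\<close> by \<open>semigroup 1 f\<close>, which obeys the weighted bound with
  another constant.\<close>

lemma semigroup_add:
  assumes \<eta>: "0 < \<eta>" "\<eta> \<le> 1" and "f \<in> borel_measurable borel"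
    and "K \<ge> 0" and "\<And>x. \<bar>f x\<bar> \<le> K * lyap \<eta> x"
  shows "semigroup (s + t) f x = semigroup s (semigroup t f) x"
  using assms(3-)
proof (induction t arbitrary: f K x)
  case 0
  have "semigroup 0 f = f" by (rule ext) (simp add: semigroup_def prob_space)
  then show ?case by simp
next
  case (Suc t)
  obtain K' where K': "K' \<ge> 0" "\<And>x. \<bar>semigroup 1 f x\<bar> \<le> K' * lyap \<eta> x"
    using semigroup_weighted_bound[OF \<eta> Suc.prems] by blast
  have step: "semigroup (Suc r) f y = semigroup r (semigroup 1 f) y" for r y
    by (intro semigroup_Suc Suc.prems semigroup_estimate(1)[OF \<eta> _ Suc.prems(3)])
  then have step': "semigroup (Suc t) f = semigroup t (semigroup 1 f)" by blast
  have "semigroup (s + Suc t) f x = semigroup (s + t) (semigroup 1 f) x" using step[of "s + t"] by simp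
  also have "\<dots> = semigroup s (semigroup t (semigroup 1 f)) x"
    by (rule Suc.IH[OF _ K']) (intro semigroup_measurable Suc.prems)
  finally show ?case by (simp only: step')
qed

lemma discounted_value_eq:
  "discounted_value M a N \<alpha> c x = (\<Sum>t. \<alpha> ^ t * semigroup t c x)"
  by (simp add: discounted_value_def semigroup_def)

lemma discounted_value_measurable:
  assumes "c \<in> borel_measurable borel"
  shows "discounted_value M a N \<alpha> c \<in> borel_measurable borel"
proof -
  note [measurable] = semigroup_measurable[OF assms]
  show ?thesis unfolding discounted_value_eq[abs_def] by measurable
qed

lemma discounted_value_bound:
  assumes \<eta>: "0 < \<eta>" "\<eta> \<le> 1" and \<alpha>: "0 < \<alpha>" "\<alpha> < 1"
    and c: "c \<in> borel_measurable borel" "K \<ge> 0" "\<And>x. \<bar>c x\<bar> \<le> K * lyap \<eta> x"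
  shows "summable (\<lambda>t. \<alpha> ^ t * semigroup t c x)"
    and "\<exists>K'\<ge>0. \<forall>x. \<bar>discounted_value M a N \<alpha> c x\<bar> \<le> K' * lyap \<eta> x"
proof -
  obtain K' where K': "K' \<ge> 0" "\<And>t x. \<bar>semigroup t c x\<bar> \<le> K' * lyap \<eta> x"
    using semigroup_weighted_bound[OF \<eta> c] by blast
  note series = discounted_series_summable[OF \<alpha> K'(1), of "\<lambda>t. semigroup t c"]
    discounted_series_bound[OF \<alpha> K'(1), of "\<lambda>t. semigroup t c"]
  show "summable (\<lambda>t. \<alpha> ^ t * semigroup t c x)"
    using series(1)[of \<eta> x] K'(2) by simp
  have "\<bar>discounted_value M a N \<alpha> c x\<bar> \<le> K' / (1 - \<alpha>) * lyap \<eta> x" for x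
    using series(2)[of \<eta> x] K'(2) by (simp add: discounted_value_eq)
  then show "\<exists>K'\<ge>0. \<forall>x. \<bar>discounted_value M a N \<alpha> c x\<bar> \<le> K' * lyap \<eta> x"
    using K' \<alpha> by (intro exI[of _ "K' / (1 - \<alpha>)"]) auto
qed

text \<open>Sum and one-step expectation commute, the terms being dominated by a geometric series
  times the weight at \<open>X 1 x\<close>; the rest is an index shift.\<close>

lemma discounted_value_fixed_point:
  assumes \<eta>: "0 < \<eta>" "\<eta> \<le> 1" and \<alpha>: "0 < \<alpha>" "\<alpha> < 1"
    and c: "c \<in> borel_measurable borel" "K \<ge> 0" "\<And>x. \<bar>c x\<bar> \<le> K * lyap \<eta> x"
  shows "discounted_value M a N \<alpha> c x = c x + \<alpha> * semigroup 1 (discounted_value M a N \<alpha> c) x"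
proof -
  note [measurable] = semigroup_measurable[OF c(1)]
  obtain K' where K': "K' \<ge> 0" "\<And>t x. \<bar>semigroup t c x\<bar> \<le> K' * lyap \<eta> x"
    using semigroup_weighted_bound[OF \<eta> c] by blast
  note summ = discounted_value_bound(1)[OF \<eta> \<alpha> c]
  let ?f = "\<lambda>t \<omega>. \<alpha> ^ t * semigroup t c (X 1 x \<omega>)"
  have int: "integrable M (?f t)" for t
    by (intro integrable_mult_right semigroup_estimate(1)[OF \<eta> _ K'(2)]) measurable
  have le: "norm (?f t \<omega>) \<le> \<alpha> ^ t * (K' * lyap \<eta> (X 1 x \<omega>))" for t \<omega>
    using \<alpha> K'(2)[of t "X 1 x \<omega>"] by (simp add: abs_mult mult_left_mono)
  have geo: "summable (\<lambda>t. \<alpha> ^ t * k)" for k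
    using \<alpha> by (intro summable_mult2 summable_geometric) auto
  have "semigroup 1 (discounted_value M a N \<alpha> c) x = (\<integral>\<omega>. (\<Sum>t. ?f t \<omega>) \<partial>M)"
    by (simp add: semigroup_def discounted_value_def)
  also have "\<dots> = (\<Sum>t. \<integral>\<omega>. ?f t \<omega> \<partial>M)"
  proof (rule integral_suminf[OF int])
    show "AE \<omega> in M. summable (\<lambda>t. norm (?f t \<omega>))"
      by (intro always_eventually allI summable_comparison_test'[OF geo, of 0]) (use le in auto)
    show "summable (\<lambda>t. \<integral>\<omega>. norm (?f t \<omega>) \<partial>M)"
    proof (rule summable_comparison_test'[OF geo, of 0])
      fix t
      have m: "(\<lambda>\<omega>. norm (?f t \<omega>)) \<in> borel_measurable M" by measurable
      from dominated_by_lyap(2)[OF \<eta> m, where K="\<alpha> ^ t * K'" and t=1 and x=x]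
      show "norm (\<integral>\<omega>. norm (?f t \<omega>) \<partial>M) \<le> \<alpha> ^ t * (K' * semigroup 1 (lyap \<eta>) x)"
        using le[of t] by (simp add: mult.assoc)
    qed
  qed
  also have "\<dots> = (\<Sum>t. \<alpha> ^ t * semigroup (Suc t) c x)"
    using semigroup_add[OF \<eta> c, of 1] by (simp add: semigroup_def)
  finally have s1: "semigroup 1 (discounted_value M a N \<alpha> c) x = (\<Sum>t. \<alpha> ^ t * semigroup (Suc t) c x)" .
  have "summable (\<lambda>t. \<alpha> ^ Suc t * semigroup (Suc t) c x)"
    using summ[of x] by (subst summable_Suc_iff)
  \<comment> \<open>The shifted series is divided by \<alpha>, which is positive.\<close>
  then have s2: "summable (\<lambda>t. \<alpha> ^ t * semigroup (Suc t) c x)"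
    using \<alpha> summable_mult[of "\<lambda>t. \<alpha> ^ Suc t * semigroup (Suc t) c x" "inverse \<alpha>"]
    by (simp add: mult.assoc[symmetric])
  have "discounted_value M a N \<alpha> c x = c x + (\<Sum>t. \<alpha> * (\<alpha> ^ t * semigroup (Suc t) c x))"
    using suminf_split_head[OF summ[of x]]
    by (simp add: discounted_value_eq semigroup_def[of 0] prob_space mult.assoc)
  with s1 suminf_mult[OF s2, of \<alpha>] show ?thesis by simp
qed

lemma discounted_value_unique:
  assumes \<eta>: "0 < \<eta>" "\<eta> \<le> 1" and \<alpha>: "0 < \<alpha>" "\<alpha> < 1"
    and c: "c \<in> borel_measurable borel" "K \<ge> 0" "\<And>x. \<bar>c x\<bar> \<le> K * lyap \<eta> x"
    and g: "g \<in> borel_measurable borel" "L \<ge> 0" "\<And>x. \<bar>g x\<bar> \<le> L * lyap \<eta> x"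
    and fp: "\<And>x. g x = c x + \<alpha> * semigroup 1 g x"
  shows "g = discounted_value M a N \<alpha> c"
proof -
  let ?h = "discounted_value M a N \<alpha> c"
  obtain H where H: "H \<ge> 0" "\<And>x. \<bar>?h x\<bar> \<le> H * lyap \<eta> x"
    using discounted_value_bound(2)[OF \<eta> \<alpha> c] by blast
  note h [measurable] = discounted_value_measurable[OF c(1), of \<alpha>]
  define d where "d x = g x - ?h x" for x
  have d: "d \<in> borel_measurable borel" unfolding d_def using g(1) h by measurable
  have dle: "\<bar>d x\<bar> \<le> (L + H) * lyap \<eta> x" for x
    using g(3)[of x] H(2)[of x] by (simp add: d_def distrib_right)
  have LH: "L + H \<ge> 0" using g H by simp
  have step: "d x = \<alpha> * semigroup 1 d x" for x
  proof -
    have "semigroup 1 d x = semigroup 1 g x - semigroup 1 ?h x"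
      using semigroup_estimate(1)[OF \<eta> g(1,3)] semigroup_estimate(1)[OF \<eta> h H(2)]
      by (simp add: semigroup_def d_def del: chain.simps)
    then have "\<alpha> * semigroup 1 d x = \<alpha> * semigroup 1 g x - \<alpha> * semigroup 1 ?h x"
      by (simp only: right_diff_distrib)
    then show ?thesis
      using fp[of x] discounted_value_fixed_point[OF \<eta> \<alpha> c, of x] unfolding d_def by linarith
  qed
  have iter: "d x = \<alpha> ^ t * semigroup t d x" for t x
  proof (induction t arbitrary: x)
    case 0
    show ?case by (simp add: semigroup_def prob_space)
  next
    case (Suc t)
    have "semigroup (Suc t) d x = semigroup t (semigroup 1 d) x"
      using semigroup_add[OF \<eta> d LH dle, of t 1] by simp
    then have "\<alpha> * semigroup (Suc t) d x = semigroup t d x"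
      by (subst step[abs_def]) (simp add: semigroup_def)
    then show ?case using Suc[of x] by (simp add: ac_simps)
  qed
  \<comment> \<open>This bound is uniform in \<open>t\<close>, so the factor
    \<open>\<alpha> ^ t\<close> in \<open>iter\<close> forces \<open>d\<close> to vanish.\<close>
  obtain D where D: "D \<ge> 0" "\<And>t x. \<bar>semigroup t d x\<bar> \<le> D * lyap \<eta> x"
    using semigroup_weighted_bound[OF \<eta> d LH dle] by blast
  have "d x = 0" for x
  proof -
    have "(\<lambda>t. \<alpha> ^ t * (D * lyap \<eta> x)) \<longlonglongrightarrow> 0 * (D * lyap \<eta> x)"
      using \<alpha> by (intro tendsto_mult LIMSEQ_power_zero tendsto_const) auto
    moreover have "\<bar>d x\<bar> \<le> \<alpha> ^ t * (D * lyap \<eta> x)" for t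
      using iter[of x t] D(2)[of t x] \<alpha> by (simp add: abs_mult mult_left_mono)
    ultimately have "\<bar>d x\<bar> \<le> 0"
      by (intro LIMSEQ_le_const[of _ 0]) auto
    then show ?thesis by simp
  qed
  then show ?thesis by (auto simp: d_def)
qed

section \<open>Continuity by truncation\<close>

text \<open>Where \<open>V \<le> r\<close> the point lies in a fixed ball and
  \<open>1 - cutoff R\<close> is small for large \<open>R\<close>; elsewhere the ratio of the two
  weights, \<open>exp (- (1 - \<eta>) * V x)\<close>, is small.\<close>

lemma cutoff_tail_small:
  assumes \<eta>: "\<eta> < 1" and \<epsilon>: "\<epsilon> > 0"
  shows "\<exists>R0\<ge>1. \<forall>R\<ge>R0. \<forall>x. (1 - cutoff R x) * lyap \<eta> x \<le> \<epsilon> * lyap 1 x"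
proof -
  \<comment> \<open>Chosen so that \<open>exp (- (1 - \<eta>) * r) \<le> \<epsilon>\<close>.\<close>
  define r where "r = \<bar>ln \<epsilon>\<bar> / (1 - \<eta>)"
  have r: "r \<ge> 0" using \<eta> by (simp add: r_def)
  obtain \<rho> where \<rho>: "\<And>x. V x \<le> r \<Longrightarrow> norm x \<le> \<rho>"
    using compact_imp_bounded[OF compact_V_sublevel[OF r]] unfolding bounded_iff by blast
  show ?thesis
  \<comment> \<open>\<open>R \<ge> 1\<close> gives \<open>R \<le> R * R\<close>, so a lower bound on
    \<open>R\<close> is one on its square.\<close>
  proof (intro exI[of _ "max 1 (2 * \<rho>\<^sup>2 / \<epsilon>)"] conjI allI impI)
    fix R x assume R: "max 1 (2 * \<rho>\<^sup>2 / \<epsilon>) \<le> R"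
    show "(1 - cutoff R x) * lyap \<eta> x \<le> \<epsilon> * lyap 1 x"
    proof (cases "V x \<le> r")
      case True
      have "R * 1 \<le> R * R" using R by (intro mult_left_mono) auto
      then have "R \<le> R\<^sup>2" by (simp add: power2_eq_square)
      then have R2: "2 * \<rho>\<^sup>2 / \<epsilon> \<le> R\<^sup>2" "R\<^sup>2 > 0" using R by auto
      have "1 - cutoff R x \<le> 2 * (x \<bullet> x) / R\<^sup>2" by (rule one_minus_cutoff_le)
      also have "\<dots> \<le> 2 * \<rho>\<^sup>2 / R\<^sup>2"
        using \<rho>[OF True] power_mono[of "norm x" \<rho> 2]
        by (intro divide_right_mono) (auto simp: dot_square_norm)
      also have "\<dots> \<le> \<epsilon>" using R2 \<epsilon> by (simp add: field_simps)
      finally show ?thesis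
        using \<eta> \<epsilon> by (intro mult_mono lyap_mono) auto
    next
      case False
      have "(1 - cutoff R x) * lyap \<eta> x \<le> 1 * lyap \<eta> x"
        using cutoff_nonneg[of R x] by (intro mult_right_mono) auto
      also have "\<dots> = exp (- ((1 - \<eta>) * V x)) * lyap 1 x"
        by (simp add: lyap_def algebra_simps flip: exp_add)
      also have "\<dots> \<le> \<epsilon> * lyap 1 x"
      proof (rule mult_right_mono)
        have "(1 - \<eta>) * r \<le> (1 - \<eta>) * V x" using False \<eta> by (intro mult_left_mono) auto
        then have "- ((1 - \<eta>) * V x) \<le> ln \<epsilon>" using \<eta> by (simp add: r_def)
        then have "exp (- ((1 - \<eta>) * V x)) \<le> exp (ln \<epsilon>)" by (subst exp_le_cancel_iff)
        then show "exp (- ((1 - \<eta>) * V x)) \<le> \<epsilon>" using \<epsilon> by simp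
      qed simp
      finally show ?thesis .
    qed
  qed auto
qed

lemma eventually_cutoff_tail_small:
  assumes "\<eta> < 1" "\<epsilon> > 0"
  shows "\<forall>\<^sub>F n in sequentially. \<forall>x. (1 - cutoff (real (Suc n)) x) * lyap \<eta> x \<le> \<epsilon> * lyap 1 x"
proof -
  obtain R0 where R0: "\<And>R x. R \<ge> R0 \<Longrightarrow> (1 - cutoff R x) * lyap \<eta> x \<le> \<epsilon> * lyap 1 x"
    using cutoff_tail_small[OF assms] by blast
  obtain n0 where "R0 \<le> real n0" using real_arch_simple by blast
  then show ?thesis
    unfolding eventually_sequentially by (intro exI[of _ n0] allI impI R0) auto
qed

text \<open>The cutoff and its gradient vanish outside the ball of radius \<open>R\<close>, on which
  the weight is bounded.\<close>

lemma cutoff_weighted_bound: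
  assumes R: "R > 0"
  shows "\<exists>m>0. \<forall>y. cutoff R y * lyap \<eta> y \<le> m \<and> norm (cutoff_grad R y) * lyap \<eta> y \<le> 4 / R * m"
proof -
  obtain m where m: "m > 0" "\<And>y. y \<in> cball 0 R \<Longrightarrow> lyap \<eta> y \<le> m"
    using lyap_bounded_on_ball by blast
  have "cutoff R y * lyap \<eta> y \<le> m \<and> norm (cutoff_grad R y) * lyap \<eta> y \<le> 4 / R * m" for y
  proof (cases "norm y \<le> R")
    case True
    then have "lyap \<eta> y \<le> m" using m by simp
    moreover from this have "norm (cutoff_grad R y) * lyap \<eta> y \<le> 4 / R * m"
      using R by (intro mult_mono norm_cutoff_grad_le) auto
    moreover have "cutoff R y * lyap \<eta> y \<le> 1 * lyap \<eta> y"
      by (intro mult_right_mono cutoff_le_1) simp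
    ultimately show ?thesis by linarith
  qed (use m R in \<open>simp add: cutoff_outside\<close>)
  with m(1) show ?thesis by blast
qed

text \<open>Truncated expectations are continuous by bounded convergence. They converge uniformly on
  unit balls, because the tail is at most \<open>K * \<epsilon>\<close> times P^t v, which is
  bounded there. Banach values serve both P^t f and Q^t g.\<close>

lemma expectation_continuous:
  fixes F :: "real ^ 'l \<Rightarrow> 'w \<Rightarrow> 'b::{banach, second_countable_topology}"
  assumes \<eta>: "0 < \<eta>" "\<eta> < 1" and K: "K \<ge> 0"
    and cont: "\<And>\<omega>. continuous_on UNIV (\<lambda>x. F x \<omega>)"
    and meas: "\<And>x. F x \<in> borel_measurable M"
    and le: "\<And>x \<omega>. norm (F x \<omega>) \<le> K * lyap \<eta> (X t x \<omega>)"
  shows "continuous_on UNIV (\<lambda>x. \<integral>\<omega>. F x \<omega> \<partial>M)"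
proof -
  \<comment> \<open>The cutoff is evaluated at the chain, since \<open>F\<close> is bounded in terms
    of \<open>X t x \<omega>\<close>: where the cutoff is nonzero, \<open>F\<close> is below a
    constant.\<close>
  define G where "G n x \<omega> = cutoff (real (Suc n)) (X t x \<omega>) *\<^sub>R F x \<omega>" for n x \<omega>
  have cm [measurable]: "cutoff R \<in> borel_measurable borel" for R :: real
    by (intro borel_measurable_continuous_onI cutoff_continuous)
  have Gm [measurable]: "G n x \<in> borel_measurable M" for n x
    unfolding G_def using meas[of x] by measurable
  have "continuous_on UNIV (\<lambda>x. \<integral>\<omega>. G n x \<omega> \<partial>M)" for n
  proof -
    obtain m where m: "\<And>y. cutoff (real (Suc n)) y * lyap \<eta> y \<le> m"
      using cutoff_weighted_bound[of "real (Suc n)" \<eta>] by auto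
    have Gb: "norm (G n x \<omega>) \<le> K * m" for x \<omega>
    proof -
      have "norm (G n x \<omega>) \<le> cutoff (real (Suc n)) (X t x \<omega>) * (K * lyap \<eta> (X t x \<omega>))"
        using cutoff_nonneg[of "real (Suc n)" "X t x \<omega>"] le[of x \<omega>]
        by (simp add: G_def mult_left_mono)
      also have "\<dots> \<le> K * m" using mult_left_mono[OF m[of "X t x \<omega>"] K] by (simp add: ac_simps)
      finally show ?thesis .
    qed
    have Gc: "continuous_on UNIV (\<lambda>x. G n x \<omega>)" for \<omega>
      unfolding G_def
      by (intro continuous_on_scaleR cont continuous_on_compose2[OF cutoff_continuous chain_continuous]) auto
    show ?thesis
      unfolding continuous_on_eq_continuous_at[OF open_UNIV]
    proof (intro ballI continuous_at_sequentiallyI)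
      fix x :: "real ^ 'l" and u assume u: "u \<longlonglongrightarrow> x"
      show "(\<lambda>k. \<integral>\<omega>. G n (u k) \<omega> \<partial>M) \<longlonglongrightarrow> (\<integral>\<omega>. G n x \<omega> \<partial>M)"
      proof (rule integral_dominated_convergence[where w="\<lambda>_. K * m"])
        have "isCont (\<lambda>x. G n x \<omega>) x" for \<omega>
          using Gc[of \<omega>] by (simp add: continuous_on_eq_continuous_at)
        then show "AE \<omega> in M. (\<lambda>k. G n (u k) \<omega>) \<longlonglongrightarrow> G n x \<omega>"
          using u by (intro always_eventually allI isCont_tendsto_compose[where g="\<lambda>x. G n x _"])
      qed (use Gb in auto)
    qed
  qed
  note Gcont = this
  obtain B where B: "B \<ge> 0" "\<And>t x. semigroup t (lyap 1) x \<le> B * lyap 1 x"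
    using semigroup_lyap_bound[of 1] by auto
  have "continuous_on (ball x0 1) (\<lambda>x. \<integral>\<omega>. F x \<omega> \<partial>M)" for x0
  proof (rule uniform_limit_theorem[OF always_eventually])
    show "uniform_limit (ball x0 1) (\<lambda>n x. \<integral>\<omega>. G n x \<omega> \<partial>M) (\<lambda>x. \<integral>\<omega>. F x \<omega> \<partial>M) sequentially"
      unfolding uniform_limit_iff
    proof (intro allI impI)
      fix e :: real assume e: "e > 0"
      obtain m where m: "m > 0" "\<And>y. y \<in> cball x0 1 \<Longrightarrow> lyap 1 y \<le> m"
        using lyap_bounded_on_ball by blast
      \<comment> \<open>The summand 1 keeps the denominator positive when
        \<open>K * B * m = 0\<close> and makes the final inequality strict.\<close>
      define \<epsilon> where "\<epsilon> = e / (K * B * m + 1)"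
      have pos: "K * B * m + 1 > 0" using K B m by (simp add: add_nonneg_pos)
      then have \<epsilon>: "\<epsilon> > 0" "K * B * m * \<epsilon> < e" using e by (auto simp: \<epsilon>_def field_simps)
      show "\<forall>\<^sub>F n in sequentially. \<forall>x\<in>ball x0 1. dist (\<integral>\<omega>. G n x \<omega> \<partial>M) (\<integral>\<omega>. F x \<omega> \<partial>M) < e"
        using eventually_cutoff_tail_small[OF \<eta>(2) \<epsilon>(1)]
      proof (rule eventually_mono, intro ballI)
        fix n x
        assume tail: "\<forall>x. (1 - cutoff (real (Suc n)) x) * lyap \<eta> x \<le> \<epsilon> * lyap 1 x"
          and x: "x \<in> ball x0 1"
        have Fi: "integrable M (F x)"
          by (rule dominated_by_lyap(1)[OF _ _ meas le]) (use \<eta> in auto)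
        have Gi: "integrable M (G n x)"
        proof (rule dominated_by_lyap(1)[where K=K and \<eta>=\<eta> and t=t and x=x])
          fix \<omega>
          have "norm (G n x \<omega>) \<le> 1 * norm (F x \<omega>)"
            unfolding G_def norm_scaleR using abs_cutoff_le_1[of "real (Suc n)" "X t x \<omega>"]
            by (intro mult_right_mono) auto
          with le[of x \<omega>] show "norm (G n x \<omega>) \<le> K * lyap \<eta> (X t x \<omega>)" by simp
        qed (use \<eta> in auto)
        have "norm (\<integral>\<omega>. F x \<omega> - G n x \<omega> \<partial>M) \<le> (K * \<epsilon>) * semigroup t (lyap 1) x"
        proof (rule dominated_by_lyap(2))
          show "(\<lambda>\<omega>. F x \<omega> - G n x \<omega>) \<in> borel_measurable M" using meas[of x] by measurable
          fix \<omega>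
          let ?c = "cutoff (real (Suc n)) (X t x \<omega>)"
          have "norm (F x \<omega> - G n x \<omega>) = norm ((1 - ?c) *\<^sub>R F x \<omega>)"
            by (simp add: G_def scaleR_diff_left)
          also have "\<dots> \<le> (1 - ?c) * (K * lyap \<eta> (X t x \<omega>))"
            unfolding norm_scaleR using cutoff_le_1[of "real (Suc n)" "X t x \<omega>"] le[of x \<omega>]
            by (intro mult_mono) auto
          also have "\<dots> \<le> K * (\<epsilon> * lyap 1 (X t x \<omega>))"
            using mult_left_mono[OF tail[rule_format, of "X t x \<omega>"] K] by (simp add: ac_simps)
          finally show "norm (F x \<omega> - G n x \<omega>) \<le> (K * \<epsilon>) * lyap 1 (X t x \<omega>)" by (simp add: ac_simps)
        qed auto
        also have "\<dots> \<le> (K * \<epsilon>) * (B * m)"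
          using K \<epsilon> B m(2)[of x] x
          by (intro mult_left_mono order_trans[OF B(2)]) auto
        also have "\<dots> < e" using \<epsilon> by (simp add: ac_simps)
        finally show "dist (\<integral>\<omega>. G n x \<omega> \<partial>M) (\<integral>\<omega>. F x \<omega> \<partial>M) < e"
          using Fi Gi by (simp add: dist_norm norm_minus_commute)
      qed
    qed
  qed (auto intro: continuous_on_subset[OF Gcont])
  then show ?thesis by (rule continuous_on_UNIV_if_ball)
qed

lemma semigroup_continuous:
  assumes \<eta>: "0 < \<eta>" "\<eta> < 1" and K: "K \<ge> 0"
    and f: "continuous_on UNIV f" "\<And>x. \<bar>f x\<bar> \<le> K * lyap \<eta> x"
  shows "continuous_on UNIV (semigroup t f)"
proof -
  have [measurable]: "f \<in> borel_measurable borel" by (rule borel_measurable_continuous_onI[OF f(1)])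
  have "continuous_on UNIV (\<lambda>x. \<integral>\<omega>. f (X t x \<omega>) \<partial>M)"
  proof (rule expectation_continuous[OF \<eta> K])
    show "continuous_on UNIV (\<lambda>x. f (X t x \<omega>))" for \<omega>
      by (rule continuous_on_compose2[OF f(1) chain_continuous]) simp
  qed (use f(2) in auto)
  then show ?thesis by (simp add: semigroup_def[abs_def])
qed

text \<open>For a single starting point u(X(t)) is an integrable bound. This supplies the pointwise
  limit when the truncations are differentiated.\<close>

lemma semigroup_cutoff_LIMSEQ:
  assumes \<eta>: "0 < \<eta>" "\<eta> \<le> 1" and f [measurable]: "f \<in> borel_measurable borel"
    and le: "\<And>x. \<bar>f x\<bar> \<le> K * lyap \<eta> x"
  shows "(\<lambda>n. semigroup t (\<lambda>y. cutoff (real (Suc n)) y * f y) x) \<longlonglongrightarrow> semigroup t f x"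
  unfolding semigroup_def
proof (rule integral_dominated_convergence[where w="\<lambda>\<omega>. K * lyap \<eta> (X t x \<omega>)"])
  have cm [measurable]: "cutoff R \<in> borel_measurable borel" for R :: real
    by (intro borel_measurable_continuous_onI cutoff_continuous)
  show "(\<lambda>\<omega>. cutoff (real (Suc n)) (X t x \<omega>) * f (X t x \<omega>)) \<in> borel_measurable M" for n
    by measurable
  show "(\<lambda>\<omega>. f (X t x \<omega>)) \<in> borel_measurable M" by measurable
  show "integrable M (\<lambda>\<omega>. K * lyap \<eta> (X t x \<omega>))"
    by (intro integrable_mult_right lyap_integrable \<eta>)
  have c1: "(\<lambda>n. cutoff (real (Suc n)) y) \<longlonglongrightarrow> 1" for y :: "real ^ 'l"
  proof -
    have "(\<lambda>n. (max 0 (1 - (y \<bullet> y) * (inverse (real (Suc n)))\<^sup>2))\<^sup>2) \<longlonglongrightarrow> (max 0 (1 - (y \<bullet> y) * 0\<^sup>2))\<^sup>2"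
      by (intro tendsto_intros LIMSEQ_inverse_real_of_nat)
    then show ?thesis by (simp add: cutoff_def divide_inverse power_inverse del: of_nat_Suc)
  qed
  show "AE \<omega> in M. (\<lambda>n. cutoff (real (Suc n)) (X t x \<omega>) * f (X t x \<omega>)) \<longlonglongrightarrow> f (X t x \<omega>)"
    using tendsto_mult[OF c1 tendsto_const] by (intro always_eventually allI) fastforce
  show "AE \<omega> in M. norm (cutoff (real (Suc n)) (X t x \<omega>) * f (X t x \<omega>)) \<le> K * lyap \<eta> (X t x \<omega>)" for n
  proof (intro always_eventually allI)
    fix \<omega>
    have "norm (cutoff (real (Suc n)) (X t x \<omega>) * f (X t x \<omega>)) \<le> 1 * \<bar>f (X t x \<omega>)\<bar>"
      unfolding real_norm_def abs_mult using abs_cutoff_le_1[of "real (Suc n)" "X t x \<omega>"]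
      by (intro mult_right_mono) auto
    with le[of "X t x \<omega>"] show "norm (cutoff (real (Suc n)) (X t x \<omega>) * f (X t x \<omega>)) \<le> K * lyap \<eta> (X t x \<omega>)"
      by simp
  qed
qed

end

section \<open>Differentiating the semigroup\<close>

locale smooth_drift_chain = drift_chain M N a V
  for M :: "'w measure"
    and N :: "nat \<Rightarrow> 'w \<Rightarrow> real ^ 'm"
    and a :: "real ^ 'l \<Rightarrow> real ^ 'm \<Rightarrow> real ^ 'l"
    and V :: "real ^ 'l \<Rightarrow> real" +
  assumes smooth: "smooth_recursion a"
begin

abbreviation jac :: "real ^ 'm \<Rightarrow> real ^ 'l \<Rightarrow> real ^ 'l ^ 'l" where
  "jac n x \<equiv> jacobian (\<lambda>y. a y n) (at x)"

lemma recursion_has_derivative: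
  "((\<lambda>y. a y n) has_derivative (\<lambda>h. jac n x *v h)) (at x)"
proof -
  have "C1_fun (\<lambda>y. a y n)" using smooth by (simp add: smooth_recursion_def)
  then have "(\<lambda>y. a y n) differentiable (at x)"
    by (auto simp: C1_fun_def differentiable_def)
  then show ?thesis by (simp add: jacobian_works)
qed

lemma jac_continuous: "continuous_on S (jac n)"
proof -
  obtain f' where f': "\<And>x. ((\<lambda>y. a y n) has_derivative blinfun_apply (f' x)) (at x)"
    and cont: "continuous_on UNIV f'"
    using smooth unfolding smooth_recursion_def C1_fun_def by blast
  have "jac n x $ i $ j = f' x (axis j 1) $ i" for x i j
    using frechet_derivative_at[OF f'[of x]] by (simp add: jacobian_def matrix_def)
  then have eq: "jac n = (\<lambda>x. \<chi> i j. f' x (axis j 1) $ i)"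
    by (simp add: fun_eq_iff vec_eq_iff)
  show ?thesis
    unfolding eq
    by (intro continuous_on_vec_lambda continuous_on_component blinfun.continuous_on
        continuous_on_subset[OF cont] continuous_on_const) auto
qed

abbreviation sens :: "nat \<Rightarrow> real ^ 'l \<Rightarrow> 'w \<Rightarrow> real ^ 'l ^ 'l" where
  "sens t x \<equiv> sensitivity a N x t"

lemma sens_Suc: "sens (Suc t) x \<omega> = jac (N (Suc t) \<omega>) (X t x \<omega>) ** sens t x \<omega>"
  by (simp add: grad_rec_def)

text \<open>Read pathwise, the recursion for the sensitivity is the chain rule for the composed
  maps.\<close>

lemma chain_has_derivative: "((\<lambda>x. X t x \<omega>) has_derivative (\<lambda>h. sens t x \<omega> *v h)) (at x)"
proof (induction t)
  case (Suc t)
  from has_derivative_compose[OF Suc recursion_has_derivative]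
  show ?case by (simp add: sens_Suc matrix_vector_mul_assoc del: sensitivity.simps)
qed simp

lemma sens_continuous: "continuous_on UNIV (\<lambda>x. sens t x \<omega>)"
proof (induction t)
  case (Suc t)
  have "continuous_on UNIV (\<lambda>x. jac (N (Suc t) \<omega>) (X t x \<omega>))"
    by (rule continuous_on_compose2[OF jac_continuous chain_continuous]) (rule subset_UNIV)
  with Suc show ?case
    unfolding sens_Suc matrix_matrix_mult_def
    by (intro continuous_on_vec_lambda continuous_on_sum continuous_on_mult continuous_on_component)
qed simp

lemma sens_bound: "\<exists>L\<ge>1. \<forall>t x \<omega> h. norm (sens t x \<omega> *v h) \<le> L ^ t * norm h"
proof -
  obtain b where b: "\<And>x n. norm (grad_rec a x n) \<le> b"
    using smooth unfolding smooth_recursion_def bounded_iff by (metis (mono_tags, lifting) case_prod_conv rangeI)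
  \<comment> \<open>Entries of the Jacobian are at most \<open>b\<close>, so its operator norm is at
    most \<open>b\<close> times the number of entries. The maximum with 1 makes the powers of
    \<open>L\<close> increase with the exponent.\<close>
  define L where "L = max 1 (real CARD('l) * real CARD('l) * b)"
  have J: "norm (jac n x *v h) \<le> L * norm h" for n x h
  proof -
    have "\<bar>jac n x $ i $ j\<bar> \<le> b" for i j
    proof -
      have "\<bar>jac n x $ i $ j\<bar> = \<bar>grad_rec a x n $ j $ i\<bar>" by (simp add: grad_rec_def transpose_def)
      also have "\<dots> \<le> norm (grad_rec a x n)"
        by (rule order_trans[OF component_le_norm_cart Finite_Cartesian_Product.norm_nth_le])
      finally show ?thesis using b[of x n] by simp
    qed
    then have "onorm ((*v) (jac n x)) \<le> L"
      unfolding L_def by (intro max.coboundedI2 onorm_le_matrix_component)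
    then have "onorm ((*v) (jac n x)) * norm h \<le> L * norm h" by (rule mult_right_mono) simp
    then show ?thesis using onorm[OF matrix_vector_mul_bounded_linear, of "jac n x" h] by simp
  qed
  have "norm (sens t x \<omega> *v h) \<le> L ^ t * norm h" for t x \<omega> h
  proof (induction t)
    case (Suc t)
    have "norm (sens (Suc t) x \<omega> *v h) \<le> L * norm (sens t x \<omega> *v h)"
      using J by (simp add: sens_Suc matrix_vector_mul_assoc[symmetric] del: sensitivity.simps)
    also have "\<dots> \<le> L * (L ^ t * norm h)" by (intro mult_left_mono Suc) (simp add: L_def)
    finally show ?case by (simp add: mult.assoc)
  qed simp
  then show ?thesis by (intro exI[of _ L]) (auto simp: L_def)
qed

section \<open>Pulled-back gradients and the operators Q^t\<close>

definition pullback :: "nat \<Rightarrow> (real ^ 'l \<Rightarrow> real ^ 'l) \<Rightarrow> real ^ 'l \<Rightarrow> 'w \<Rightarrow> real ^ 'l" where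
  "pullback t g x \<omega> = transpose (sens t x \<omega>) *v g (X t x \<omega>)"

text \<open>The case split at time 0 disappears: the initial sensitivity is the identity and
  \<open>M\<close> has mass 1.\<close>

lemma Q_op_eq: "Q_op M a N t g x = (\<integral>\<omega>. pullback t g x \<omega> \<partial>M)"
  by (simp add: Q_op_def pullback_def prob_space transpose_mat)

lemma pullback_inner: "pullback t g x \<omega> \<bullet> h = g (X t x \<omega>) \<bullet> (sens t x \<omega> *v h)"
  unfolding pullback_def by (rule inner_transpose_mult)

lemma pullback_diff: "pullback t f x \<omega> - pullback t g x \<omega> = pullback t (\<lambda>y. f y - g y) x \<omega>"
  by (simp only: pullback_def matrix_vector_mult_diff_distrib)

text \<open>The sensitivity applied to \<open>h\<close> is a limit of difference quotients of the
  chain, each measurable in the noise; the coordinates of the pullback are inner products with such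
  vectors.\<close>

lemma pullback_measurable:
  assumes [measurable]: "g \<in> borel_measurable borel"
  shows "pullback t g x \<in> borel_measurable M"
proof -
  have "(\<lambda>\<omega>. sens t x \<omega> *v h) \<in> borel_measurable M" for h
    by (rule borel_measurable_LIMSEQ_metric[OF _ has_derivative_imp_directional_LIMSEQ[OF chain_has_derivative]])
      measurable
  note [measurable] = this
  have "(\<lambda>\<omega>. g (X t x \<omega>) \<bullet> (sens t x \<omega> *v h)) \<in> borel_measurable M" for h by measurable
  then show ?thesis
    by (subst borel_measurable_euclidean_space) (simp add: pullback_inner)
qed

lemma pullback_continuous:
  assumes "continuous_on UNIV g"
  shows "continuous_on UNIV (\<lambda>x. pullback t g x \<omega>)"
proof -
  have "continuous_on UNIV (\<lambda>x. g (X t x \<omega>))"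
    by (rule continuous_on_compose2[OF assms chain_continuous]) simp
  then show ?thesis
    unfolding pullback_def matrix_vector_mult_def transpose_def
    using sens_continuous[of t \<omega>]
    by (simp, intro continuous_on_vec_lambda continuous_on_sum continuous_on_mult continuous_on_component)
qed

abbreviation Q :: "nat \<Rightarrow> (real ^ 'l \<Rightarrow> real ^ 'l) \<Rightarrow> real ^ 'l \<Rightarrow> real ^ 'l" where
  "Q \<equiv> Q_op M a N"

definition sens_growth :: real where
  "sens_growth = (SOME L. L \<ge> 1 \<and> (\<forall>t x \<omega> h. norm (sens t x \<omega> *v h) \<le> L ^ t * norm h))"

lemma sens_growth: "sens_growth \<ge> 1" "norm (sens t x \<omega> *v h) \<le> sens_growth ^ t * norm h"
  using someI_ex[OF sens_bound] unfolding sens_growth_def by blast+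

lemma sens_growth_power_nonneg [simp]: "0 \<le> sens_growth ^ t"
  using sens_growth(1) by (intro zero_le_power) linarith

lemma norm_pullback_le: "norm (pullback t g x \<omega>) \<le> sens_growth ^ t * norm (g (X t x \<omega>))"
  unfolding pullback_def by (intro norm_transpose_mult_le sens_growth(2))

lemma norm_pullback_lyap_le:
  assumes "\<And>y. norm (g y) \<le> D * lyap \<eta> y"
  shows "norm (pullback t g x \<omega>) \<le> sens_growth ^ t * D * lyap \<eta> (X t x \<omega>)"
  using norm_pullback_le[of t g x \<omega>] mult_left_mono[OF assms[of "X t x \<omega>"] sens_growth_power_nonneg[of t]]
  by (simp add: mult.assoc)

lemma Q_estimate:
  assumes \<eta>: "0 < \<eta>" "\<eta> \<le> 1" and g: "g \<in> borel_measurable borel"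
    and le: "\<And>y. norm (g y) \<le> D * lyap \<eta> y"
  shows "integrable M (pullback t g x)"
    and "norm (Q t g x) \<le> sens_growth ^ t * D * semigroup t (lyap \<eta>) x"
  using dominated_by_lyap[OF \<eta> pullback_measurable[OF g], OF norm_pullback_lyap_le[OF le]]
  by (simp_all add: Q_op_eq)

lemma Q_continuous:
  assumes \<eta>: "0 < \<eta>" "\<eta> < 1" and g: "continuous_on UNIV g"
    and D: "D \<ge> 0" and le: "\<And>y. norm (g y) \<le> D * lyap \<eta> y"
  shows "continuous_on UNIV (Q t g)"
proof -
  have "continuous_on UNIV (\<lambda>x. \<integral>\<omega>. pullback t g x \<omega> \<partial>M)"
    using D by (intro expectation_continuous[OF \<eta> _ pullback_continuous[OF g]
          pullback_measurable[OF borel_measurable_continuous_onI[OF g]] norm_pullback_lyap_le[OF le]]) auto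
  then show ?thesis by (simp add: Q_op_eq[abs_def])
qed

text \<open>The reason for the transpose in \<open>pullback\<close>: it turns the gradient of
  \<open>f\<close> into the gradient of \<open>f\<close> composed with the chain.\<close>

lemma chain_compose_has_derivative:
  assumes "\<And>y. (f has_derivative (\<lambda>h. g y \<bullet> h)) (at y)"
  shows "((\<lambda>x. f (X t x \<omega>)) has_derivative (\<lambda>h. pullback t g x \<omega> \<bullet> h)) (at x)"
  using has_derivative_compose[OF chain_has_derivative assms] by (simp add: pullback_inner)

text \<open>With a bounded gradient, \<open>f (X t x \<omega>)\<close> is Lipschitz in
  \<open>x\<close> with a constant independent of the noise, so the relative first-order remainders
  are bounded and bounded convergence applies.\<close>

lemma semigroup_has_derivative_bounded:
  assumes f: "\<And>y. (f has_derivative (\<lambda>h. g y \<bullet> h)) (at y)" and g: "continuous_on UNIV g"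
    and fb: "\<And>y. \<bar>f y\<bar> \<le> K" and gb: "\<And>y. norm (g y) \<le> D"
  shows "(semigroup t f has_derivative (\<lambda>h. Q t g x \<bullet> h)) (at x)"
proof -
  define \<Lambda> where "\<Lambda> = sens_growth ^ t * D"
  have pb: "norm (pullback t g y \<omega>) \<le> \<Lambda>" for y \<omega>
    using norm_pullback_le[of t g y \<omega>] mult_left_mono[OF gb[of "X t y \<omega>"] sens_growth_power_nonneg[of t]]
    by (simp add: \<Lambda>_def)
  have lip: "\<bar>f (X t y \<omega>) - f (X t z \<omega>)\<bar> \<le> \<Lambda> * norm (y - z)" for y z \<omega>
  proof -
    have "onorm ((\<bullet>) (pullback t g u \<omega>)) \<le> \<Lambda>" for u
    proof (rule onorm_le)
      fix h
      have "norm (pullback t g u \<omega> \<bullet> h) \<le> norm (pullback t g u \<omega>) * norm h"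
        by (simp add: Cauchy_Schwarz_ineq2)
      also have "\<dots> \<le> \<Lambda> * norm h" by (intro mult_right_mono pb) simp
      finally show "norm (pullback t g u \<omega> \<bullet> h) \<le> \<Lambda> * norm h" .
    qed
    then show ?thesis
      using differentiable_bound[of UNIV "\<lambda>x. f (X t x \<omega>)" "\<lambda>u. (\<bullet>) (pullback t g u \<omega>)" \<Lambda> y z]
        chain_compose_has_derivative[OF f, of t \<omega>] by simp
  qed
  have "continuous_on UNIV f"
    by (rule has_derivative_imp_continuous_on_UNIV[OF f])
  then have [measurable]: "f \<in> borel_measurable borel" by (rule borel_measurable_continuous_onI)
  have gm: "g \<in> borel_measurable borel" by (rule borel_measurable_continuous_onI[OF g])
  note [measurable] = pullback_measurable[OF gm]
  have fi: "integrable M (\<lambda>\<omega>. f (X t y \<omega>))" for y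
    by (rule integrable_const_bound[where B=K]) (use fb in auto)
  have pi: "integrable M (pullback t g x)"
    by (rule integrable_const_bound[where B=\<Lambda>]) (use pb in auto)
  show ?thesis
    unfolding has_derivative_at
  proof (intro conjI)
    show "(\<lambda>h. norm (semigroup t f (x + h) - semigroup t f x - Q t g x \<bullet> h) / norm h) \<midarrow>0\<rightarrow> 0"
      unfolding tendsto_at_iff_sequentially
    proof (intro allI impI)
      fix u :: "nat \<Rightarrow> real ^ 'l" assume u0: "\<forall>k. u k \<in> UNIV - {0}" and u: "u \<longlonglongrightarrow> 0"
      \<comment> \<open>The relative remainder; the increment of \<open>f\<close> and the linear
        term contribute at most \<open>\<Lambda>\<close> each to its bound.\<close>
      define q where "q k \<omega> = (f (X t (x + u k) \<omega>) - f (X t x \<omega>) - pullback t g x \<omega> \<bullet> u k) / norm (u k)" for k \<omega>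
      have qm [measurable]: "q k \<in> borel_measurable M" for k
        unfolding q_def by measurable
      have "(\<lambda>k. \<integral>\<omega>. q k \<omega> \<partial>M) \<longlonglongrightarrow> (\<integral>\<omega>. 0 \<partial>M)"
      proof (rule integral_dominated_convergence[where w="\<lambda>_. 2 * \<Lambda>"])
        show "AE \<omega> in M. (\<lambda>k. q k \<omega>) \<longlonglongrightarrow> 0"
        proof (intro always_eventually allI)
          fix \<omega>
          have "(\<lambda>h. norm (f (X t (x + h) \<omega>) - f (X t x \<omega>) - pullback t g x \<omega> \<bullet> h) / norm h) \<midarrow>0\<rightarrow> 0"
            using chain_compose_has_derivative[OF f, of t \<omega> x] by (simp add: has_derivative_at)
          then have "(\<lambda>k. norm (q k \<omega>)) \<longlonglongrightarrow> 0"
            using u u0 unfolding tendsto_at_iff_sequentially by (auto simp: comp_def q_def)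
          then show "(\<lambda>k. q k \<omega>) \<longlonglongrightarrow> 0" by (simp add: tendsto_rabs_zero_iff)
        qed
        show "AE \<omega> in M. norm (q k \<omega>) \<le> 2 * \<Lambda>" for k
        proof (intro always_eventually allI)
          fix \<omega>
          have "\<bar>pullback t g x \<omega> \<bullet> u k\<bar> \<le> \<Lambda> * norm (u k)"
            by (rule order_trans[OF Cauchy_Schwarz_ineq2]) (intro mult_right_mono pb, simp)
          moreover have "\<bar>f (X t (x + u k) \<omega>) - f (X t x \<omega>)\<bar> \<le> \<Lambda> * norm (u k)"
            using lip[of "x + u k" \<omega> x] by simp
          ultimately have "\<bar>f (X t (x + u k) \<omega>) - f (X t x \<omega>) - pullback t g x \<omega> \<bullet> u k\<bar> \<le> 2 * \<Lambda> * norm (u k)"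
            by linarith
          then show "norm (q k \<omega>) \<le> 2 * \<Lambda>" using u0 by (simp add: q_def pos_divide_le_eq)
        qed
      qed auto
      moreover have "(\<integral>\<omega>. q k \<omega> \<partial>M) = (semigroup t f (x + u k) - semigroup t f x - Q t g x \<bullet> u k) / norm (u k)" for k
        unfolding q_def semigroup_def Q_op_eq using fi pi by simp
      ultimately have "(\<lambda>k. (semigroup t f (x + u k) - semigroup t f x - Q t g x \<bullet> u k) / norm (u k)) \<longlonglongrightarrow> 0"
        by simp
      from tendsto_norm_zero[OF this]
      show "((\<lambda>h. norm (semigroup t f (x + h) - semigroup t f x - Q t g x \<bullet> h) / norm h) \<circ> u) \<longlonglongrightarrow> 0"
        by (simp add: comp_def)
    qed
  qed (rule bounded_linear_inner_right)
qed

section \<open>Truncated functions and their gradients\<close>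

definition cut_grad :: "real \<Rightarrow> (real ^ 'l \<Rightarrow> real) \<Rightarrow> (real ^ 'l \<Rightarrow> real ^ 'l) \<Rightarrow> real ^ 'l \<Rightarrow> real ^ 'l" where
  "cut_grad R f g y = cutoff R y *\<^sub>R g y + f y *\<^sub>R cutoff_grad R y"

lemma cutoff_mult_has_derivative:
  assumes "(f has_derivative (\<lambda>h. g y \<bullet> h)) (at y)"
  shows "((\<lambda>y. cutoff R y * f y) has_derivative (\<lambda>h. cut_grad R f g y \<bullet> h)) (at y)"
  using has_derivative_mult[OF cutoff_has_derivative assms]
  by (simp add: cut_grad_def inner_add_left mult.commute)

text \<open>The discarded part of \<open>g\<close> is small by the tail estimate and gives
  \<open>D * \<epsilon>\<close>; the derivative of the cutoff, at most \<open>4 / R\<close>,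
  multiplies \<open>f\<close> and gives \<open>4 * K / R\<close>. That \<open>D\<close> occurs only
  together with \<epsilon> is what later yields a contraction.\<close>

lemma Q_cut_grad_error:
  assumes \<eta>: "0 < \<eta>" "\<eta> \<le> 1" and f: "continuous_on UNIV f" "\<And>y. \<bar>f y\<bar> \<le> K * lyap \<eta> y" "K \<ge> 0"
    and g: "continuous_on UNIV g" "\<And>y. norm (g y) \<le> D * lyap \<eta> y" "D \<ge> 0"
    and R: "R > 0" and tail: "\<And>y. (1 - cutoff R y) * lyap \<eta> y \<le> \<epsilon> * lyap 1 y"
  shows "norm (Q t g x - Q t (cut_grad R f g) x) \<le> sens_growth ^ t * (D * \<epsilon> + 4 * K / R) * semigroup t (lyap 1) x"
proof -
  let ?g = "cut_grad R f g"
  have gR: "continuous_on UNIV ?g"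
    unfolding cut_grad_def by (intro continuous_intros cutoff_continuous cutoff_grad_continuous f g)
  have err: "norm (g y - ?g y) \<le> (D * \<epsilon> + 4 * K / R) * lyap 1 y" for y
  proof -
    have "norm (g y - ?g y) = norm ((1 - cutoff R y) *\<^sub>R g y - f y *\<^sub>R cutoff_grad R y)"
      by (simp add: cut_grad_def scaleR_diff_left diff_diff_eq)
    also have "\<dots> \<le> (1 - cutoff R y) * norm (g y) + \<bar>f y\<bar> * norm (cutoff_grad R y)"
      using cutoff_le_1[of R y] by (intro order_trans[OF norm_triangle_ineq4]) simp
    also have "\<dots> \<le> (1 - cutoff R y) * (D * lyap \<eta> y) + (K * lyap 1 y) * (4 / R)"
    proof (intro add_mono mult_mono mult_left_mono)
      have "K * lyap \<eta> y \<le> K * lyap 1 y" using \<eta> f by (intro mult_left_mono lyap_mono) auto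
      with f(2)[of y] show "\<bar>f y\<bar> \<le> K * lyap 1 y" by linarith
    qed (use f g R cutoff_le_1[of R y] norm_cutoff_grad_le[of R y] in auto)
    also have "\<dots> \<le> D * (\<epsilon> * lyap 1 y) + (K * lyap 1 y) * (4 / R)"
      using mult_left_mono[OF tail[of y] g(3)] by (simp add: ac_simps)
    finally show ?thesis by (simp add: algebra_simps)
  qed
  have gi: "integrable M (pullback t g x)"
    by (rule Q_estimate(1)[OF \<eta> borel_measurable_continuous_onI[OF g(1)] g(2)])
  have dm: "(\<lambda>y. g y - ?g y) \<in> borel_measurable borel"
    by (intro borel_measurable_continuous_onI continuous_on_diff g gR)
  have di: "integrable M (pullback t (\<lambda>y. g y - ?g y) x)"
    by (rule Q_estimate(1)[OF _ _ dm err]) auto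
  have "pullback t ?g x = (\<lambda>\<omega>. pullback t g x \<omega> - pullback t (\<lambda>y. g y - ?g y) x \<omega>)"
    by (simp add: fun_eq_iff flip: pullback_diff)
  then have "Q t ?g x = Q t g x - Q t (\<lambda>y. g y - ?g y) x"
    unfolding Q_op_eq using gi di by simp
  then show ?thesis using Q_estimate(2)[OF _ _ dm err, where t=t and x=x] by simp
qed

lemma cut_grad_bounded:
  assumes f: "\<And>y. \<bar>f y\<bar> \<le> K * lyap \<eta> y" "K \<ge> 0"
    and g: "\<And>y. norm (g y) \<le> D * lyap \<eta> y" "D \<ge> 0" and R: "R > 0"
  shows "\<exists>m. \<forall>y. \<bar>cutoff R y * f y\<bar> \<le> K * m \<and> norm (cut_grad R f g y) \<le> D * m + K * (4 / R * m)"
proof -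
  obtain m where m: "m > 0" "\<And>y. cutoff R y * lyap \<eta> y \<le> m" "\<And>y. norm (cutoff_grad R y) * lyap \<eta> y \<le> 4 / R * m"
    using cutoff_weighted_bound[OF R] by blast
  have "\<bar>cutoff R y * f y\<bar> \<le> K * m" for y
  proof -
    have "\<bar>cutoff R y * f y\<bar> \<le> cutoff R y * (K * lyap \<eta> y)"
      unfolding abs_mult using cutoff_nonneg[of R y] f(1)[of y] by (simp add: mult_left_mono)
    also have "\<dots> \<le> K * m" using mult_left_mono[OF m(2)[of y] f(2)] by (simp add: ac_simps)
    finally show ?thesis .
  qed
  moreover have "norm (cut_grad R f g y) \<le> D * m + K * (4 / R * m)" for y
  proof -
    have "norm (cut_grad R f g y) \<le> cutoff R y * norm (g y) + \<bar>f y\<bar> * norm (cutoff_grad R y)"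
      unfolding cut_grad_def using cutoff_nonneg[of R y] by (intro order_trans[OF norm_triangle_ineq]) simp
    also have "\<dots> \<le> cutoff R y * (D * lyap \<eta> y) + (K * lyap \<eta> y) * norm (cutoff_grad R y)"
      using cutoff_nonneg[of R y] by (intro add_mono mult_left_mono mult_right_mono f g) auto
    also have "\<dots> \<le> D * m + K * (4 / R * m)"
      using mult_left_mono[OF m(2)[of y] g(2)] mult_left_mono[OF m(3)[of y] f(2)] by (simp add: ac_simps)
    finally show ?thesis .
  qed
  ultimately show ?thesis by blast
qed

lemma semigroup_cutoff_has_derivative:
  assumes f: "\<And>y. (f has_derivative (\<lambda>h. g y \<bullet> h)) (at y)" "\<And>y. \<bar>f y\<bar> \<le> K * lyap \<eta> y" "K \<ge> 0"
    and g: "continuous_on UNIV g" "\<And>y. norm (g y) \<le> D * lyap \<eta> y" "D \<ge> 0" and R: "R > 0"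
  shows "(semigroup t (\<lambda>y. cutoff R y * f y) has_derivative (\<lambda>h. Q t (cut_grad R f g) x \<bullet> h)) (at x)"
proof -
  have fc: "continuous_on UNIV f"
    by (rule has_derivative_imp_continuous_on_UNIV[OF f(1)])
  have gR: "continuous_on UNIV (cut_grad R f g)"
    unfolding cut_grad_def by (intro continuous_intros cutoff_continuous cutoff_grad_continuous fc g)
  obtain m where "\<And>y. \<bar>cutoff R y * f y\<bar> \<le> K * m" "\<And>y. norm (cut_grad R f g y) \<le> D * m + K * (4 / R * m)"
    using cut_grad_bounded[OF f(2,3) g(2,3) R] by blast
  then show ?thesis
    by (rule semigroup_has_derivative_bounded[OF cutoff_mult_has_derivative[OF f(1)] gR])
qed

text \<open>The truncations converge pointwise and their gradients converge uniformly on a ball, so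
  the limit is differentiable with the limiting gradient.\<close>

lemma semigroup_has_derivative:
  assumes \<eta>: "0 < \<eta>" "\<eta> < 1"
    and f: "\<And>y. (f has_derivative (\<lambda>h. g y \<bullet> h)) (at y)" "\<And>y. \<bar>f y\<bar> \<le> K * lyap \<eta> y" "K \<ge> 0"
    and g: "continuous_on UNIV g" "\<And>y. norm (g y) \<le> D * lyap \<eta> y" "D \<ge> 0"
  shows "(semigroup t f has_derivative (\<lambda>h. Q t g x \<bullet> h)) (at x)"
proof -
  have fc: "continuous_on UNIV f"
    by (rule has_derivative_imp_continuous_on_UNIV[OF f(1)])
  have \<eta>1: "\<eta> \<le> 1" using \<eta> by simp
  define F where "F n = semigroup t (\<lambda>y. cutoff (real (Suc n)) y * f y)" for n
  define G where "G n = Q t (cut_grad (real (Suc n)) f g)" for n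
  have lim: "(\<lambda>n. F n y) \<longlonglongrightarrow> semigroup t f y" for y
    unfolding F_def by (rule semigroup_cutoff_LIMSEQ[OF \<eta>(1) \<eta>1 borel_measurable_continuous_onI[OF fc] f(2)])
  obtain B where B: "B \<ge> 0" "\<And>t x. semigroup t (lyap 1) x \<le> B * lyap 1 x"
    using semigroup_lyap_bound[of 1] by auto
  obtain m where m: "m > 0" "\<And>y. y \<in> cball x 1 \<Longrightarrow> lyap 1 y \<le> m"
    using lyap_bounded_on_ball by blast
  have "\<exists>\<phi>. \<forall>y\<in>ball x 1. (\<lambda>n. F n y) \<longlonglongrightarrow> \<phi> y \<and> (\<phi> has_derivative (\<lambda>h. Q t g y \<bullet> h)) (at y within ball x 1)"
  proof (rule has_derivative_sequence[where ?x0.0=x])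
    show "(F n has_derivative (\<lambda>h. G n y \<bullet> h)) (at y within ball x 1)" for n y
      unfolding F_def G_def
      by (rule has_derivative_at_withinI[OF semigroup_cutoff_has_derivative[OF f g]]) simp
  next
    fix e :: real assume e: "e > 0"
    \<comment> \<open>Bounds \<open>sens_growth ^ t * semigroup t (lyap 1) y\<close> for all
      \<open>y\<close> in the ball.\<close>
    define k where "k = sens_growth ^ t * (B * m)"
    have k: "k \<ge> 0" using B m by (simp add: k_def)
    \<comment> \<open>Gives the tail of \<open>g\<close> half of \<open>e\<close>; the term from the
      derivative of the cutoff gets the other half for large \<open>n\<close>.\<close>
    define \<epsilon> where "\<epsilon> = e / (2 * (k * D + 1))"
    have "k * D + 1 > 0" using k g by (simp add: add_nonneg_pos)
    then have \<epsilon>: "\<epsilon> > 0" "k * D * \<epsilon> \<le> e / 2" using e by (auto simp: \<epsilon>_def field_simps)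
    have "(\<lambda>n. k * (4 * K) * inverse (real (Suc n))) \<longlonglongrightarrow> k * (4 * K) * 0"
      by (intro tendsto_intros LIMSEQ_inverse_real_of_nat)
    then have "\<forall>\<^sub>F n in sequentially. k * (4 * K) * inverse (real (Suc n)) < e / 2"
      using e by (intro order_tendstoD) auto
    with eventually_cutoff_tail_small[OF \<eta>(2) \<epsilon>(1)]
    show "\<forall>\<^sub>F n in sequentially. \<forall>y\<in>ball x 1. \<forall>h. norm (G n y \<bullet> h - Q t g y \<bullet> h) \<le> e * norm h"
    proof eventually_elim
      fix n assume tail: "\<forall>x. (1 - cutoff (real (Suc n)) x) * lyap \<eta> x \<le> \<epsilon> * lyap 1 x"
        and small: "k * (4 * K) * inverse (real (Suc n)) < e / 2"
      show "\<forall>y\<in>ball x 1. \<forall>h. norm (G n y \<bullet> h - Q t g y \<bullet> h) \<le> e * norm h"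
      proof (intro ballI allI)
        fix y h assume y: "y \<in> ball x 1"
        have "norm (Q t g y - G n y)
            \<le> sens_growth ^ t * (D * \<epsilon> + 4 * K / real (Suc n)) * semigroup t (lyap 1) y"
          unfolding G_def by (rule Q_cut_grad_error[OF \<eta>(1) \<eta>1 fc f(2,3) g _ tail[rule_format]]) simp
        also have "\<dots> \<le> sens_growth ^ t * (D * \<epsilon> + 4 * K / real (Suc n)) * (B * m)"
        proof (rule mult_left_mono)
          have "B * lyap 1 y \<le> B * m" using B(1) m(2)[of y] y by (intro mult_left_mono) auto
          then show "semigroup t (lyap 1) y \<le> B * m" by (rule order_trans[OF B(2)])
          show "0 \<le> sens_growth ^ t * (D * \<epsilon> + 4 * K / real (Suc n))"
            using f(3) g(3) \<epsilon>(1) by simp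
        qed
        also have "\<dots> = k * D * \<epsilon> + k * (4 * K) * inverse (real (Suc n))"
          by (simp add: k_def algebra_simps divide_inverse del: of_nat_Suc)
        also have "\<dots> \<le> e" using \<epsilon> small by linarith
        finally have le: "norm (Q t g y - G n y) \<le> e" .
        have "norm (G n y \<bullet> h - Q t g y \<bullet> h) = \<bar>(G n y - Q t g y) \<bullet> h\<bar>" by (simp add: inner_diff_left)
        also have "\<dots> \<le> norm (G n y - Q t g y) * norm h" by (rule Cauchy_Schwarz_ineq2)
        also have "\<dots> \<le> e * norm h" using le by (intro mult_right_mono) (auto simp: norm_minus_commute)
        finally show "norm (G n y \<bullet> h - Q t g y \<bullet> h) \<le> e * norm h" .
      qed
    qed
  qed (use lim in auto)
  then obtain \<phi> where \<phi>: "\<And>y. y \<in> ball x 1 \<Longrightarrow> (\<lambda>n. F n y) \<longlonglongrightarrow> \<phi> y"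
    "\<And>y. y \<in> ball x 1 \<Longrightarrow> (\<phi> has_derivative (\<lambda>h. Q t g y \<bullet> h)) (at y within ball x 1)" by blast
  have eq: "\<phi> y = semigroup t f y" if "y \<in> ball x 1" for y
    using LIMSEQ_unique[OF \<phi>(1)[OF that] lim] .
  have "(semigroup t f has_derivative (\<lambda>h. Q t g x \<bullet> h)) (at x within ball x 1)"
    by (rule has_derivative_transform[OF _ _ \<phi>(2)]) (auto simp: eq)
  then show ?thesis by (simp add: at_within_open[of x "ball x 1"])
qed

text \<open>The sensitivity may grow like \<open>sens_growth ^ t\<close>, faster than \<open>\<alpha> ^ t\<close> decays. The density
  prevents this: far out, the drift condition beats the growth over \<open>t\<close> steps; near the origin,
  the part of \<open>f\<close> on a large ball is smoothed by the density, so that only \<open>\<bar>f\<bar>\<close> matters, and the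
  rest contributes little.\<close>

lemma Q_density_contraction:
  assumes \<eta>: "0 < \<eta>" "\<eta> < 1" and t: "t \<ge> 1" and K: "K \<ge> 0"
    and p: "C1_fun p"
    "\<forall>x. \<forall>A\<in>sets borel. set_integrable lborel A (\<lambda>y. p (x, y)) \<and>
      measure (trans_kernel M a N t x) A = (LINT y:A|lborel. p (x, y))"
  shows "\<exists>C\<ge>0. \<forall>f g D. (\<forall>y. (f has_derivative (\<lambda>h. g y \<bullet> h)) (at y)) \<longrightarrow> (\<forall>y. \<bar>f y\<bar> \<le> K * lyap \<eta> y) \<longrightarrow>
      continuous_on UNIV g \<longrightarrow> (\<forall>y. norm (g y) \<le> D * lyap \<eta> y) \<longrightarrow> D \<ge> 0 \<longrightarrow>
      (\<forall>x. norm (Q t g x) \<le> (D / 2 + C) * lyap \<eta> x)"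
proof -
  define \<Lambda> where "\<Lambda> = sens_growth ^ t"
  have \<Lambda>: "\<Lambda> \<ge> 1" using sens_growth(1) by (simp add: \<Lambda>_def one_le_power)
  have \<eta>1: "\<eta> \<le> 1" using \<eta> by simp
  \<comment> \<open>Beats the growth of the sensitivity over \<open>t\<close> steps:
    \<open>\<Lambda> * ?\<epsilon>\<close> is 1/4, and \<open>t \<ge> 1\<close> gives
    \<open>?\<epsilon> ^ t \<le> ?\<epsilon>\<close>.\<close>
  let ?\<epsilon> = "1 / (4 * \<Lambda>)"
  have \<epsilon>: "0 < ?\<epsilon>" "?\<epsilon> < 1" using \<Lambda> by (auto simp: field_simps)
  obtain B where B: "B \<ge> 0" "\<And>t x. semigroup t (lyap \<eta>) x \<le> ?\<epsilon> ^ t * lyap \<eta> x + B"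
    using semigroup_lyap_contraction[OF \<eta>(1) \<eta>1 \<epsilon>] by blast
  \<comment> \<open>Where \<open>V\<close> exceeds \<open>r\<close> the weight is above
    \<open>4 * \<Lambda> * B\<close>, so the additive term \<open>\<Lambda> * B\<close> costs at
    most another quarter of the weight.\<close>
  define r where "r = max 0 (ln (4 * \<Lambda> * B + 1) / \<eta>)"
  have "r \<ge> 0" by (simp add: r_def)
  then obtain \<rho> where \<rho>: "\<And>x. V x \<le> r \<Longrightarrow> norm x \<le> \<rho>"
    using compact_imp_bounded[OF compact_V_sublevel] unfolding bounded_iff by blast
  obtain m where m: "m > 0" "\<And>y. y \<in> cball 0 \<rho> \<Longrightarrow> lyap 1 y \<le> m"
    using lyap_bounded_on_ball by blast
  obtain B1 where B1: "B1 \<ge> 0" "\<And>t x. semigroup t (lyap 1) x \<le> B1 * lyap 1 x"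
    using semigroup_lyap_bound[of 1] by auto
  define k where "k = \<Lambda> * (B1 * m)"
  have k: "k \<ge> 0" using \<Lambda> B1 m by (simp add: k_def)
  \<comment> \<open>With \<open>k * e \<le> 1 / 2\<close> the discarded part of \<open>g\<close>
    contributes at most \<open>D / 2\<close>.\<close>
  define e where "e = 1 / (2 * (k + 1))"
  have e: "e > 0" "k * e \<le> 1 / 2" using k by (auto simp: e_def field_simps)
  obtain R where R: "R \<ge> 1" "\<And>y. (1 - cutoff R y) * lyap \<eta> y \<le> e * lyap 1 y"
    using cutoff_tail_small[OF \<eta>(2) e(1)] by blast
  have R0: "R > 0" using R by simp
  obtain m' where m': "m' > 0" "\<And>y. cutoff R y * lyap \<eta> y \<le> m'"
    using cutoff_weighted_bound[OF R0] by blast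
  \<comment> \<open>The radius \<open>\<rho> + 1\<close> leaves room for a unit ball around every
    \<open>x\<close> with \<open>norm x \<le> \<rho>\<close>.\<close>
  obtain C1 where C1: "C1 \<ge> 0" and lip: "\<And>f k x x'. \<lbrakk>f \<in> borel_measurable borel; \<And>y. \<bar>f y\<bar> \<le> k;
      \<And>y. norm y > R \<Longrightarrow> f y = 0; x \<in> cball 0 (\<rho> + 1); x' \<in> cball 0 (\<rho> + 1)\<rbrakk>
      \<Longrightarrow> \<bar>semigroup t f x - semigroup t f x'\<bar> \<le> C1 * k * norm (x - x')"
    using semigroup_local_Lipschitz[OF p, of R "\<rho> + 1"] by blast
  \<comment> \<open>The two contributions free of \<open>D\<close>: the derivative of the cutoff,
    and the Lipschitz constant of the smoothed truncation.\<close>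
  define C where "C = k * (4 * K / R) + C1 * (K * m')"
  have C: "C \<ge> 0" using k K R C1 m' by (simp add: C_def)
  have "norm (Q t g x) \<le> (D / 2 + C) * lyap \<eta> x"
    if f: "\<And>y. (f has_derivative (\<lambda>h. g y \<bullet> h)) (at y)" "\<And>y. \<bar>f y\<bar> \<le> K * lyap \<eta> y"
      and g: "continuous_on UNIV g" "\<And>y. norm (g y) \<le> D * lyap \<eta> y" "D \<ge> 0" for f g D x
  proof (cases "V x \<le> r")
    case False
    have "norm (Q t g x) \<le> \<Lambda> * D * semigroup t (lyap \<eta>) x"
      unfolding \<Lambda>_def by (rule Q_estimate(2)[OF \<eta>(1) \<eta>1 borel_measurable_continuous_onI[OF g(1)] g(2)])
    also have "\<dots> \<le> \<Lambda> * D * (?\<epsilon> * lyap \<eta> x + B)"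
    proof (rule mult_left_mono)
      have "?\<epsilon> ^ t \<le> ?\<epsilon> ^ 1" using \<epsilon> t by (intro power_decreasing) auto
      then have "?\<epsilon> ^ t * lyap \<eta> x \<le> ?\<epsilon> * lyap \<eta> x" by (intro mult_right_mono) auto
      with B(2)[of t x] show "semigroup t (lyap \<eta>) x \<le> ?\<epsilon> * lyap \<eta> x + B" by linarith
    qed (use \<Lambda> g in auto)
    also have "\<dots> = D * (lyap \<eta> x / 4 + \<Lambda> * B)"
      using \<Lambda> by (simp add: field_simps)
    also have "\<dots> \<le> D * (lyap \<eta> x / 2)"
    proof (rule mult_left_mono)
      have "4 * \<Lambda> * B + 1 > 0" using \<Lambda> B by (simp add: add_nonneg_pos)
      moreover have "ln (4 * \<Lambda> * B + 1) \<le> \<eta> * V x"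
      proof -
        have "ln (4 * \<Lambda> * B + 1) / \<eta> \<le> V x" using False unfolding r_def by linarith
        then show ?thesis using \<eta> by (simp add: pos_divide_le_eq mult.commute)
      qed
      ultimately have "4 * \<Lambda> * B + 1 \<le> lyap \<eta> x"
        unfolding lyap_def by (metis exp_le_cancel_iff exp_ln)
      then show "lyap \<eta> x / 4 + \<Lambda> * B \<le> lyap \<eta> x / 2" by simp
    qed (use g in simp)
    also have "\<dots> \<le> (D / 2 + C) * lyap \<eta> x" using C by (simp add: distrib_right)
    finally show ?thesis .
  next
    case True
    then have x: "norm x \<le> \<rho>" by (rule \<rho>)
    let ?f = "\<lambda>y. cutoff R y * f y" and ?g = "cut_grad R f g"
    have fc: "continuous_on UNIV f" by (rule has_derivative_imp_continuous_on_UNIV[OF f(1)])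
    have "norm (Q t g x - Q t ?g x) \<le> \<Lambda> * (D * e + 4 * K / R) * semigroup t (lyap 1) x"
      unfolding \<Lambda>_def by (rule Q_cut_grad_error[OF \<eta>(1) \<eta>1 fc f(2) K g R0 R(2)])
    also have "\<dots> \<le> \<Lambda> * (D * e + 4 * K / R) * (B1 * m)"
    proof (rule mult_left_mono)
      have "B1 * lyap 1 x \<le> B1 * m" using B1(1) m(2)[of x] x by (intro mult_left_mono) auto
      then show "semigroup t (lyap 1) x \<le> B1 * m" by (rule order_trans[OF B1(2)])
    qed (use \<Lambda> g e K R in auto)
    also have "\<dots> = D * (k * e) + k * (4 * K / R)" by (simp add: k_def algebra_simps)
    also have "\<dots> \<le> D * (1 / 2) + k * (4 * K / R)"
      by (intro add_right_mono mult_left_mono e g)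
    finally have 1: "norm (Q t g x - Q t ?g x) \<le> D / 2 + k * (4 * K / R)" by simp
    \<comment> \<open>The truncated function is at most \<open>K * m'\<close> and vanishes off a
      ball, so the density makes its image under P^t Lipschitz near \<open>x\<close>; the gradient
      of that image is \<open>Q t ?g\<close>.\<close>
    have 2: "norm (Q t ?g x) \<le> C1 * (K * m')"
    proof (rule norm_gradient_le_Lipschitz)
      show "(semigroup t ?f has_derivative (\<lambda>h. Q t ?g x \<bullet> h)) (at x)"
        by (rule semigroup_cutoff_has_derivative[OF f K g R0])
      fix y assume "dist y x < 1"
      then have "norm y \<le> \<rho> + 1" using x norm_triangle_ineq2[of y x] by (simp add: dist_norm)
      then show "\<bar>semigroup t ?f y - semigroup t ?f x\<bar> \<le> C1 * (K * m') * norm (y - x)"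
      proof (intro lip)
        show "?f \<in> borel_measurable borel"
          by (intro borel_measurable_continuous_onI continuous_on_mult cutoff_continuous fc)
        fix z
        have "\<bar>?f z\<bar> \<le> cutoff R z * (K * lyap \<eta> z)"
          unfolding abs_mult using cutoff_nonneg[of R z] f(2)[of z] by (simp add: mult_left_mono)
        also have "\<dots> \<le> K * m'" using mult_left_mono[OF m'(2)[of z] K] by (simp add: ac_simps)
        finally show "\<bar>?f z\<bar> \<le> K * m'" .
        show "?f z = 0" if "norm z > R" using cutoff_outside[OF R0 that] by simp
      qed (use x in auto)
    qed (use C1 K m' in auto)
    have "norm (Q t g x) \<le> norm (Q t ?g x) + norm (Q t g x - Q t ?g x)"
      by (metis add.commute diff_add_cancel norm_triangle_ineq)
    also have "\<dots> \<le> (D / 2 + C) * 1" using 1 2 by (simp add: C_def)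
    also have "\<dots> \<le> (D / 2 + C) * lyap \<eta> x"
      using g C \<eta> by (intro mult_left_mono lyap_ge_1) auto
    finally show ?thesis .
  qed
  with C show ?thesis by blast
qed

text \<open>Strong induction in blocks of \<open>t0\<close>. The contraction is applied to P^s c
  with gradient Q^s g; its constant is chosen from \<open>K'\<close>, which bounds P^s c for all s,
  so the same \<open>C\<close> serves every block.\<close>

lemma Q_uniform_bound:
  assumes \<eta>: "0 < \<eta>" "\<eta> < 1" and dens: "smooth_density M a N"
    and c: "\<And>y. (c has_derivative (\<lambda>h. g y \<bullet> h)) (at y)" "\<And>y. \<bar>c y\<bar> \<le> K * lyap \<eta> y" "K \<ge> 0"
    and g: "continuous_on UNIV g" "\<And>y. norm (g y) \<le> D * lyap \<eta> y" "D \<ge> 0"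
  shows "\<exists>D'\<ge>0. \<forall>t x. norm (Q t g x) \<le> D' * lyap \<eta> x"
proof -
  obtain t0 p where t0: "t0 \<ge> 1" and p: "C1_fun p"
    "\<forall>x. \<forall>A\<in>sets borel. set_integrable lborel A (\<lambda>y. p (x, y)) \<and>
      measure (trans_kernel M a N t0 x) A = (LINT y:A|lborel. p (x, y))"
    using dens unfolding smooth_density_def by blast
  have \<eta>1: "\<eta> \<le> 1" using \<eta> by simp
  have cc: "continuous_on UNIV c" by (rule has_derivative_imp_continuous_on_UNIV[OF c(1)])
  note cm = borel_measurable_continuous_onI[OF cc]
  obtain K' where K': "K' \<ge> 0" "\<And>t x. \<bar>semigroup t c x\<bar> \<le> K' * lyap \<eta> x"
    using semigroup_weighted_bound[OF \<eta>(1) \<eta>1 cm c(3,2)] by blast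
  obtain C where C: "C \<ge> 0" and contr: "\<And>f g D x. \<lbrakk>\<And>y. (f has_derivative (\<lambda>h. g y \<bullet> h)) (at y);
      \<And>y. \<bar>f y\<bar> \<le> K' * lyap \<eta> y; continuous_on UNIV g; \<And>y. norm (g y) \<le> D * lyap \<eta> y; D \<ge> 0\<rbrakk>
      \<Longrightarrow> norm (Q t0 g x) \<le> (D / 2 + C) * lyap \<eta> x"
    using Q_density_contraction[OF \<eta> t0 K'(1) p] by blast
  obtain B where B: "B \<ge> 0" "\<And>t x. semigroup t (lyap \<eta>) x \<le> B * lyap \<eta> x"
    using semigroup_lyap_bound[OF \<eta>(1) \<eta>1] by blast
  \<comment> \<open>A number at least \<open>2 * C\<close> is not increased by halving it and adding
    \<open>C\<close>; the other entry covers the times below \<open>t0\<close> by the crude growth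
    bound.\<close>
  define D' where "D' = max (2 * C) (sens_growth ^ t0 * D * B)"
  have D': "D' \<ge> 0" "D' / 2 + C \<le> D'" using C by (auto simp: D'_def)
  have Qc: "continuous_on UNIV (Q t g)" for t by (rule Q_continuous[OF \<eta> g(1,3,2)])
  have deriv: "(semigroup t c has_derivative (\<lambda>h. Q t g x \<bullet> h)) (at x)" for t x
    by (rule semigroup_has_derivative[OF \<eta> c g])
  have "norm (Q t g x) \<le> D' * lyap \<eta> x" for t x
  proof (induction t arbitrary: x rule: less_induct)
    case (less t)
    show ?case
    proof (cases "t < t0")
      case True
      have "norm (Q t g x) \<le> sens_growth ^ t * D * semigroup t (lyap \<eta>) x"
        by (rule Q_estimate(2)[OF \<eta>(1) \<eta>1 borel_measurable_continuous_onI[OF g(1)] g(2)])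
      also have "\<dots> \<le> sens_growth ^ t0 * D * (B * lyap \<eta> x)"
        using True sens_growth(1) g(3)
        by (intro mult_mono B(2) power_increasing semigroup_lyap_nonneg mult_nonneg_nonneg) auto
      also have "\<dots> = (sens_growth ^ t0 * D * B) * lyap \<eta> x" by (simp add: mult.assoc)
      also have "\<dots> \<le> D' * lyap \<eta> x"
        unfolding D'_def by (intro mult_right_mono max.cobounded2 lyap_nonneg)
      finally show ?thesis .
    next
      case False
      then obtain s where s: "t = t0 + s" using le_Suc_ex not_le by blast
      have IH: "norm (Q s g y) \<le> D' * lyap \<eta> y" for y
        using less.IH[of s] s t0 by simp
      \<comment> \<open>Differentiating P^t c as P^t0 (P^s c) gives a second expression for its
        gradient, and uniqueness of the derivative identifies the two.\<close>
      have "(semigroup t c has_derivative (\<lambda>h. Q t0 (Q s g) x \<bullet> h)) (at x)"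
      proof -
        have "semigroup t c = semigroup t0 (semigroup s c)"
          unfolding s by (rule ext) (rule semigroup_add[OF \<eta>(1) \<eta>1 cm c(3,2)])
        then show ?thesis
          using semigroup_has_derivative[OF \<eta> deriv K'(2,1) Qc IH D'(1)] by simp
      qed
      from has_derivative_unique[OF deriv this] have "Q t g x = Q t0 (Q s g) x"
        by (metis vector_eq_ldot inner_commute)
      then have "norm (Q t g x) \<le> (D' / 2 + C) * lyap \<eta> x"
        using contr[OF deriv K'(2) Qc IH D'(1)] by simp
      also have "\<dots> \<le> D' * lyap \<eta> x" by (intro mult_right_mono D'(2) lyap_nonneg)
      finally show ?thesis .
    qed
  qed
  with D'(1) show ?thesis by blast
qed

section \<open>Differentiating the discounted series term by term\<close>

lemma discounted_value_has_derivative: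
  assumes \<eta>: "0 < \<eta>" "\<eta> < 1" and \<alpha>: "0 < \<alpha>" "\<alpha> < 1"
    and c: "\<And>y. (c has_derivative (\<lambda>h. g y \<bullet> h)) (at y)" "\<And>y. \<bar>c y\<bar> \<le> K * lyap \<eta> y" "K \<ge> 0"
    and g: "continuous_on UNIV g" "\<And>y. norm (g y) \<le> D * lyap \<eta> y" "D \<ge> 0"
    and D': "D' \<ge> 0" "\<And>t x. norm (Q t g x) \<le> D' * lyap \<eta> x"
  shows "(discounted_value M a N \<alpha> c has_derivative (\<lambda>h. (\<Sum>t. \<alpha> ^ t *\<^sub>R Q t g x) \<bullet> h)) (at x)"
proof -
  let ?G = "\<lambda>y. \<Sum>t. \<alpha> ^ t *\<^sub>R Q t g y"
  have \<eta>1: "\<eta> \<le> 1" using \<eta> by simp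
  have cm: "c \<in> borel_measurable borel"
    by (intro borel_measurable_continuous_onI has_derivative_imp_continuous_on_UNIV[OF c(1)])
  have sums: "(\<lambda>t. \<alpha> ^ t * semigroup t c y) sums discounted_value M a N \<alpha> c y" for y
    using summable_sums[OF discounted_value_bound(1)[OF \<eta>(1) \<eta>1 \<alpha> cm c(3,2)]]
    by (simp add: discounted_value_eq)
  have "\<exists>\<phi>. \<forall>y\<in>ball x 1. (\<lambda>t. \<alpha> ^ t * semigroup t c y) sums \<phi> y \<and>
      (\<phi> has_derivative (\<lambda>h. ?G y \<bullet> h)) (at y within ball x 1)"
  proof (rule has_derivative_series[where x=x])
    show "((\<lambda>y. \<alpha> ^ t * semigroup t c y) has_derivative (\<lambda>h. \<alpha> ^ t * (Q t g y \<bullet> h))) (at y within ball x 1)" for t y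
      by (rule has_derivative_mult_right[OF has_derivative_at_withinI[OF semigroup_has_derivative[OF \<eta> c g]]])
  next
    fix e :: real assume "e > 0"
    \<comment> \<open>Local uniform convergence of the gradients comes from the bound
      \<open>D'\<close>, which is uniform in \<open>t\<close>.\<close>
    then have "\<forall>\<^sub>F n in sequentially. \<forall>y\<in>ball x 1. dist (\<Sum>t<n. \<alpha> ^ t *\<^sub>R Q t g y) (?G y) < e"
      by (rule uniform_limitD[OF discounted_series_uniform[where u="\<lambda>t. Q t g", OF \<alpha> D']])
    then show "\<forall>\<^sub>F n in sequentially. \<forall>y\<in>ball x 1. \<forall>h.
        norm ((\<Sum>t<n. \<alpha> ^ t * (Q t g y \<bullet> h)) - ?G y \<bullet> h) \<le> e * norm h"
    proof (eventually_elim, intro ballI allI)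
      fix n y h
      assume "\<forall>y\<in>ball x 1. dist (\<Sum>t<n. \<alpha> ^ t *\<^sub>R Q t g y) (?G y) < e" "y \<in> ball x 1"
      then have le: "norm ((\<Sum>t<n. \<alpha> ^ t *\<^sub>R Q t g y) - ?G y) \<le> e" by (auto simp: dist_norm less_imp_le)
      have "(\<Sum>t<n. \<alpha> ^ t * (Q t g y \<bullet> h)) - ?G y \<bullet> h = ((\<Sum>t<n. \<alpha> ^ t *\<^sub>R Q t g y) - ?G y) \<bullet> h"
        by (simp add: inner_diff_left inner_sum_left)
      also have "norm \<dots> \<le> norm ((\<Sum>t<n. \<alpha> ^ t *\<^sub>R Q t g y) - ?G y) * norm h"
        unfolding real_norm_def by (rule Cauchy_Schwarz_ineq2)
      also have "\<dots> \<le> e * norm h" using le by (rule mult_right_mono) simp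
      finally show "norm ((\<Sum>t<n. \<alpha> ^ t * (Q t g y \<bullet> h)) - ?G y \<bullet> h) \<le> e * norm h" .
    qed
  qed (use sums in auto)
  then obtain \<phi> where \<phi>: "\<And>y. y \<in> ball x 1 \<Longrightarrow> (\<lambda>t. \<alpha> ^ t * semigroup t c y) sums \<phi> y"
    "\<And>y. y \<in> ball x 1 \<Longrightarrow> (\<phi> has_derivative (\<lambda>h. ?G y \<bullet> h)) (at y within ball x 1)" by blast
  have eq: "\<phi> y = discounted_value M a N \<alpha> c y" if "y \<in> ball x 1" for y
    using sums_unique2[OF \<phi>(1)[OF that] sums] .
  have "(discounted_value M a N \<alpha> c has_derivative (\<lambda>h. ?G x \<bullet> h)) (at x within ball x 1)"
    by (rule has_derivative_transform[OF _ _ \<phi>(2)]) (auto simp: eq)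
  then show ?thesis by (simp add: at_within_open[of x "ball x 1"])
qed

end

theorem theorem2p4:
  fixes M :: "'w measure"
    and N :: "nat \<Rightarrow> 'w \<Rightarrow> real ^ 'm"
    and a :: "real ^ 'l \<Rightarrow> real ^ 'm \<Rightarrow> real ^ 'l"
    and V c :: "real ^ 'l \<Rightarrow> real"
    and \<eta> \<alpha> :: real
  assumes noise: "iid_noise M N"
    and cont: "continuous_on UNIV (\<lambda>(x, n). a x n)"
    and A1: "smooth_recursion a"
    and A2: "smooth_density M a N"
    and A3: "reachable_state M a N"
    and A4: "drift_DV3 M a N V"
    and eta: "0 < \<eta>" "\<eta> \<le> 1"
    and c: "c \<in> Linf (\<lambda>x. exp (V x) powr \<eta>)"
    and alpha: "0 < \<alpha>" "\<alpha> < 1"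
  shows
    "(\<forall>x t. integrable M (\<lambda>\<omega>. c (chain a N x t \<omega>))) \<and>
     (\<forall>x. summable (\<lambda>t. \<alpha> ^ t * (\<integral>\<omega>. c (chain a N x t \<omega>) \<partial>M))) \<and>
     discounted_value M a N \<alpha> c \<in> Linf (\<lambda>x. exp (V x) powr \<eta>) \<and>
     (\<forall>x. integrable (trans_kernel M a N 1 x) (discounted_value M a N \<alpha> c)) \<and>
     (\<forall>x. c x + \<alpha> * trans_op M a N (discounted_value M a N \<alpha> c) x
            - discounted_value M a N \<alpha> c x = 0) \<and>
     (\<forall>g \<in> Linf (\<lambda>x. exp (V x) powr \<eta>).
        (\<forall>x. c x + \<alpha> * trans_op M a N g x - g x = 0) \<longrightarrow> g = discounted_value M a N \<alpha> c) \<and>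
     (\<eta> < 1 \<longrightarrow>
        (c \<in> Linf0 (\<lambda>x. exp (V x) powr \<eta>) \<longrightarrow>
           discounted_value M a N \<alpha> c \<in> Linf0 (\<lambda>x. exp (V x) powr \<eta>)) \<and>
        (c \<in> Linf1 (\<lambda>x. exp (V x) powr \<eta>) \<longrightarrow>
           discounted_value M a N \<alpha> c \<in> Linf1 (\<lambda>x. exp (V x) powr \<eta>) \<and>
           (\<forall>x t. integrable M
              (\<lambda>\<omega>. transpose (sensitivity a N x t \<omega>) *v gradient c (chain a N x t \<omega>))) \<and>
           (\<forall>x. (\<lambda>t. \<alpha> ^ t *\<^sub>R Q_op M a N t (gradient c) x)
                  sums gradient (discounted_value M a N \<alpha> c) x)))"
proof -
  interpret smooth_drift_chain M N a V
    by unfold_locales (fact noise cont A4 A1)+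
  let ?h = "discounted_value M a N \<alpha> c"
  let ?w = "\<lambda>x. exp (V x) powr \<eta>"
  obtain K where cm: "c \<in> borel_measurable borel" and K: "K \<ge> 0" "\<And>x. \<bar>c x\<bar> \<le> K * lyap \<eta> x"
    using c unfolding Linf_lyap_iff by blast
  note cK = cm K
  have h: "?h \<in> Linf ?w"
    using discounted_value_measurable[OF cm] discounted_value_bound(2)[OF eta alpha cK]
    by (simp add: Linf_lyap_iff)
  then obtain H where hm: "?h \<in> borel_measurable borel" and H: "H \<ge> 0" "\<And>x. \<bar>?h x\<bar> \<le> H * lyap \<eta> x"
    unfolding Linf_lyap_iff by blast
  have int: "integrable M (\<lambda>\<omega>. c (X t x \<omega>))" for x t
    by (rule semigroup_estimate(1)[OF eta cm K(2)])
  have summ: "summable (\<lambda>t. \<alpha> ^ t * (\<integral>\<omega>. c (X t x \<omega>) \<partial>M))" for x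
    using discounted_value_bound(1)[OF eta alpha cK] by (simp add: semigroup_def)
  have hint: "integrable (trans_kernel M a N 1 x) ?h" for x
    using semigroup_estimate(1)[OF eta hm H(2)] hm
    unfolding trans_kernel_def by (subst integrable_distr_eq) (auto simp del: chain.simps)
  have fixed: "c x + \<alpha> * trans_op M a N ?h x - ?h x = 0" for x
    using discounted_value_fixed_point[OF eta alpha cK, of x] trans_op_eq_semigroup[OF hm, of x] by simp
  have unique: "g = ?h"
    if g: "g \<in> Linf ?w" and fp: "\<forall>x. c x + \<alpha> * trans_op M a N g x - g x = 0" for g
  proof -
    obtain L where gL: "g \<in> borel_measurable borel" "L \<ge> 0" "\<And>x. \<bar>g x\<bar> \<le> L * lyap \<eta> x"
      using g unfolding Linf_lyap_iff by blast
    have "g x = c x + \<alpha> * semigroup 1 g x" for x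
      using fp[rule_format, of x] trans_op_eq_semigroup[OF gL(1), of x] by simp
    then show ?thesis by (rule discounted_value_unique[OF eta alpha cK gL])
  qed
  have smooth0: "?h \<in> Linf0 ?w" if \<eta>: "\<eta> < 1" and c0: "c \<in> Linf0 ?w"
  proof -
    have cc: "continuous_on UNIV c" using c0 by (simp add: Linf0_def)
    obtain K' where K': "K' \<ge> 0" "\<And>t x. norm (semigroup t c x) \<le> K' * lyap \<eta> x"
      using semigroup_weighted_bound[OF eta cK] by auto
    have "continuous_on UNIV (semigroup t c)" for t
      by (rule semigroup_continuous[OF eta(1) \<eta> K(1) cc K(2)])
    from discounted_series_continuous[OF alpha K' this]
    show ?thesis using h by (simp add: Linf0_def discounted_value_eq[abs_def])
  qed
  have smooth1: "?h \<in> Linf1 ?w" "integrable M (pullback t (gradient c) x)"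
      "(\<lambda>t. \<alpha> ^ t *\<^sub>R Q t (gradient c) x) sums gradient ?h x"
    if \<eta>: "\<eta> < 1" and c1: "c \<in> Linf1 ?w" for x t
  proof -
    note c' = Linf1_lyapD(1)[OF c1] and gc = Linf1_lyapD(2)[OF c1]
    obtain D where D: "D \<ge> 0" "\<And>x. norm (gradient c x) \<le> D * lyap \<eta> x"
      using Linf1_lyapD(3)[OF c1] by blast
    \<comment> \<open>(A2) enters here. The pathwise bound alone would require
      \<open>\<alpha> * sens_growth < 1\<close> for the gradient series to converge.\<close>
    obtain D' where D': "D' \<ge> 0" "\<And>t x. norm (Q t (gradient c) x) \<le> D' * lyap \<eta> x"
      using Q_uniform_bound[OF eta(1) \<eta> A2 c' K(2,1) gc D(2,1)] by blast
    let ?G = "\<lambda>x. \<Sum>t. \<alpha> ^ t *\<^sub>R Q t (gradient c) x"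
    have h': "(?h has_derivative (\<lambda>h. ?G x \<bullet> h)) (at x)" for x
      by (rule discounted_value_has_derivative[OF eta(1) \<eta> alpha c' K(2,1) gc D(2,1) D'])
    have Gc: "continuous_on UNIV ?G"
      by (intro discounted_series_continuous[OF alpha D'] Q_continuous[OF eta(1) \<eta> gc D])
    show "?h \<in> Linf1 ?w"
      by (rule Linf1_lyapI[OF h h' Gc discounted_series_bound[where u="\<lambda>t. Q t (gradient c)", OF alpha D']])
        (use alpha D'(1) in simp)
    show "integrable M (pullback t (gradient c) x)"
      by (rule Q_estimate(1)[OF eta borel_measurable_continuous_onI[OF gc] D(2)])
    show "(\<lambda>t. \<alpha> ^ t *\<^sub>R Q t (gradient c) x) sums gradient ?h x"
      using summable_sums[OF discounted_series_summable[OF alpha D']] gradient_eqI[OF h'] by simp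
  qed
  show ?thesis
    using int summ h hint fixed unique smooth0 smooth1 unfolding pullback_def[abs_def] by blast
qed

end
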